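(* Let $\mathcal X$ be the space of infinite sequences over the alphabet $\{0,1\}$ with no two consecutive letters $11$, and let $G$ be the group of bijections of $\mathcal X$ generated by the transformations $a_i,b_i,c_i,d_i$, $i\in\{0,1,2\}$, defined recursively (action from the right) by $$(00w)\cdot a_0 = 10w,\quad (10w)\cdot a_0 = 00w,\quad (010w)\cdot a_0 = 010w,$$ $$(00w)\cdot b_0 = 10w,\quad (10w)\cdot b_0 = 00w,\quad (010w)\cdot b_0 = 010(w\cdot c_0),$$ $$(00w)\cdot c_0 = 10w,\quad (10w)\cdot c_0 = 00w,\quad (010w)\cdot c_0 = 010(w\cdot d_0),$$ $$(00w)\cdot d_0 = 00w,\quad (10w)\cdot d_0 = 10w,\quad (010w)\cdot d_0 = 010(w\cdot b_0),$$ and, for each $x\in\{a,b,c,d\}$, $$(0w)\cdot x_1=0(w\cdot x_0),\quad (10w)\cdot x_1=10w,\qquad (0w)\cdot x_2=0w,\quad (10w)\cdot x_2=10(w\cdot x_0).$$ Then the growth function of $G$ satisfies $\gamma_G(R)\preceq\exp(R^{0.9181})$.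
   Context: For a group $G$ with finite symmetric generating set $S$ (here the set of the transformations $a_i,b_i,c_i,d_i$, which are involutions), $|g|$ is the minimal $\ell\in\mathbb{N}$ such that $g$ is a product of $\ell$ elements of $S$, and $\gamma_G(R)$ is the number of $g\in G$ with $|g|\le R$. The notation $f_1(R)\preceq f_2(R)$ means that there exists $C\ge 1$ with $f_1(R)\le f_2(CR)$ for all $R\ge 1$. *)

theory Defs
  imports
    Complex_Main
    "HOL-Algebra.Bij"
    "HOL-Algebra.Generated_Groups"
    "HOL-Library.Stream"
    "HOL-Library.BNF_Corec"
    "HOL-Library.Z2"
begin

definition word_length :: "('g, 'm) monoid_scheme \<Rightarrow> 'g set \<Rightarrow> 'g \<Rightarrow> nat" where
  "word_length G S g =
     (LEAST l. \<exists>ws. length ws = l \<and> set ws \<subseteq> S \<and> foldr (\<lambda>s h. s \<otimes>\<^bsub>G\<^esub> h) ws \<one>\<^bsub>G\<^esub> = g)"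

definition growth :: "('g, 'm) monoid_scheme \<Rightarrow> 'g set \<Rightarrow> real \<Rightarrow> nat" where
  "growth G S R = card {g \<in> carrier G. real (word_length G S g) \<le> R}"

definition growth_le :: "(real \<Rightarrow> real) \<Rightarrow> (real \<Rightarrow> real) \<Rightarrow> bool" (infix \<open>\<preceq>\<close> 50) where
  "f\<^sub>1 \<preceq> f\<^sub>2 \<longleftrightarrow> (\<exists>C\<ge>1. \<forall>R\<ge>1. f\<^sub>1 R \<le> f\<^sub>2 (C * R))"

definition \<X> :: "bit stream set" where
  "\<X> = {w. \<forall>n. \<not> (w !! n = 1 \<and> w !! Suc n = 1)}"

datatype label = La | Lb | Lc | Ld

text \<open>\<open>successor x\<close> is the label \<open>y\<close> with \<open>(010w) \<cdot> x\<^sub>0 = 010(w \<cdot> y\<^sub>0)\<close>;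
  it is \<open>None\<close> for \<open>a\<close>, where the tail \<open>w\<close> is left unchanged.\<close>

fun successor :: "label \<Rightarrow> label option" where
  "successor La = None"
| "successor Lb = Some Lc"
| "successor Lc = Some Ld"
| "successor Ld = Some Lb"

text \<open>Elements of \<open>\<X>\<close> start with \<open>00\<close>, \<open>10\<close> or \<open>010\<close>.
  The remaining branches only make the functions total.\<close>

corec act0 :: "label \<Rightarrow> bit stream \<Rightarrow> bit stream" where
  "act0 x v =
     (if stake 2 v = [0, 0] then (if x = Ld then v else 1 ## 0 ## sdrop 2 v)
      else if stake 2 v = [1, 0] then (if x = Ld then v else 0 ## 0 ## sdrop 2 v)
      else if stake 3 v = [0, 1, 0] then
        (case successor x of
           None \<Rightarrow> v
         | Some y \<Rightarrow> 0 ## 1 ## 0 ## act0 y (sdrop 3 v))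
      else v)"

definition act1 :: "label \<Rightarrow> bit stream \<Rightarrow> bit stream" where
  "act1 x v = (if shd v = 0 then 0 ## act0 x (stl v) else v)"

definition act2 :: "label \<Rightarrow> bit stream \<Rightarrow> bit stream" where
  "act2 x v = (if stake 2 v = [1, 0] then 1 ## 0 ## act0 x (sdrop 2 v) else v)"

lemma act0_00:
  "act0 La (0 ## 0 ## w) = 1 ## 0 ## w"
  "act0 Lb (0 ## 0 ## w) = 1 ## 0 ## w"
  "act0 Lc (0 ## 0 ## w) = 1 ## 0 ## w"
  "act0 Ld (0 ## 0 ## w) = 0 ## 0 ## w"
  by (subst act0.code; simp add: numeral_2_eq_2)+

lemma act0_10:
  "act0 La (1 ## 0 ## w) = 0 ## 0 ## w"
  "act0 Lb (1 ## 0 ## w) = 0 ## 0 ## w"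
  "act0 Lc (1 ## 0 ## w) = 0 ## 0 ## w"
  "act0 Ld (1 ## 0 ## w) = 1 ## 0 ## w"
  by (subst act0.code; simp add: numeral_2_eq_2)+

lemma act0_010:
  "act0 La (0 ## 1 ## 0 ## w) = 0 ## 1 ## 0 ## w"
  "act0 Lb (0 ## 1 ## 0 ## w) = 0 ## 1 ## 0 ## act0 Lc w"
  "act0 Lc (0 ## 1 ## 0 ## w) = 0 ## 1 ## 0 ## act0 Ld w"
  "act0 Ld (0 ## 1 ## 0 ## w) = 0 ## 1 ## 0 ## act0 Lb w"
  by (subst act0.code; simp add: numeral_2_eq_2 numeral_3_eq_3)+

lemma act1_simps:
  "act1 x (0 ## w) = 0 ## act0 x w"
  "act1 x (1 ## 0 ## w) = 1 ## 0 ## w"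
  by (simp_all add: act1_def)

lemma act2_simps:
  "act2 x (0 ## w) = 0 ## w"
  "act2 x (1 ## 0 ## w) = 1 ## 0 ## act0 x w"
  by (simp_all add: act2_def numeral_2_eq_2)

definition generators :: "(bit stream \<Rightarrow> bit stream) set" where
  "generators = {restrict (f x) \<X> | f x. f \<in> {act0, act1, act2}}"

text \<open>Products in \<^const>\<open>BijGroup\<close> are compositions of left actions; for the action from the
  right, \<open>w \<cdot> (g h) = (w \<cdot> g) \<cdot> h\<close>, the order of the factors is reversed.\<close>

definition RBijGroup :: "'a set \<Rightarrow> ('a \<Rightarrow> 'a) monoid" where
  "RBijGroup X = (BijGroup X)\<lparr>mult := \<lambda>g h. h \<otimes>\<^bsub>BijGroup X\<^esub> g\<rparr>"

definition \<G> :: "(bit stream \<Rightarrow> bit stream) monoid" where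
  "\<G> = (RBijGroup \<X>)\<lparr>carrier := generate (RBijGroup \<X>) generators\<rparr>"

lemma group_RBijGroup: "group (RBijGroup X)"
proof -
  interpret B: group "BijGroup X" by (rule group_BijGroup)
  show ?thesis
  proof (rule groupI)
    fix g assume "g \<in> carrier (RBijGroup X)"
    then show "\<exists>h\<in>carrier (RBijGroup X). h \<otimes>\<^bsub>RBijGroup X\<^esub> g = \<one>\<^bsub>RBijGroup X\<^esub>"
      by (intro bexI[of _ "inv\<^bsub>BijGroup X\<^esub> g"]) (simp_all add: RBijGroup_def)
  qed (auto simp: RBijGroup_def B.m_assoc)
qed

lemma \<X>_Cons: "b ## w \<in> \<X> \<longleftrightarrow> \<not> (b = 1 \<and> shd w = 1) \<and> w \<in> \<X>"
proof -
  have all_nat: "(\<forall>n. P n) \<longleftrightarrow> P 0 \<and> (\<forall>n. P (Suc n))" for P :: "nat \<Rightarrow> bool"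
    by (metis not0_implies_Suc)
  show ?thesis
    unfolding \<X>_def mem_Collect_eq by (subst all_nat) simp
qed

lemma \<X>_cases:
  assumes "v \<in> \<X>"
  obtains w where "v = 0 ## 0 ## w" "w \<in> \<X>"
  | w where "v = 1 ## 0 ## w" "w \<in> \<X>"
  | w where "v = 0 ## 1 ## 0 ## w" "w \<in> \<X>"
proof -
  obtain p q r w where v: "v = p ## q ## r ## w"
    by (metis stream.collapse)
  show thesis
    using assms that unfolding v by (cases p; cases q; cases r) (auto simp: \<X>_Cons)
qed

lemma act0_closed:
  assumes "v \<in> \<X>"
  shows "act0 x v \<in> \<X>"
proof -
  have "\<not> (act0 x v !! n = 1 \<and> act0 x v !! Suc n = 1)" for n
    using assms
  proof (induction n arbitrary: x v rule: less_induct)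
    case (less n)
    from less.prems show ?case
    proof (cases rule: \<X>_cases)
      case (1 w)
      then show ?thesis
        by (cases x; cases n; cases "n - 1") (auto simp: act0_00 \<X>_def)
    next
      case (2 w)
      then show ?thesis
        by (cases x; cases n; cases "n - 1") (auto simp: act0_10 \<X>_def)
    next
      case (3 w)
      have IH: "\<not> (act0 y w !! m = 1 \<and> act0 y w !! Suc m = 1)" if "n = Suc (Suc (Suc m))" for y m
        using less.IH[of m w y] that 3 by simp
      consider "n = 0" | "n = Suc 0" | "n = Suc (Suc 0)" | m where "n = Suc (Suc (Suc m))"
        by (metis not0_implies_Suc)
      then show ?thesis
        using IH less.prems 3 by cases (cases x; auto simp: act0_010 \<X>_def)+
    qed
  qed
  then show ?thesis
    by (auto simp: \<X>_def)
qed

lemma act0_involution: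
  assumes "v \<in> \<X>"
  shows "act0 x (act0 x v) = v"
proof -
  have "act0 x (act0 x v) !! n = v !! n" for n
    using assms
  proof (induction n arbitrary: x v rule: less_induct)
    case (less n)
    from less.prems show ?case
    proof (cases rule: \<X>_cases)
      case (3 w)
      have IH: "act0 y (act0 y w) !! m = w !! m" if "n = Suc (Suc (Suc m))" for y m
        using less.IH[of m w y] that 3 by simp
      consider "n = 0" | "n = Suc 0" | "n = Suc (Suc 0)" | m where "n = Suc (Suc (Suc m))"
        by (metis not0_implies_Suc)
      then show ?thesis
        using IH 3 by cases (cases x; simp add: act0_010)+
    qed (cases x; simp add: act0_00 act0_10)+
  qed
  then show ?thesis
    by (metis stream_smap_nats stream.map_cong0 ext)
qed

lemma generators_subset: "generators \<subseteq> carrier (RBijGroup \<X>)"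
  and generators_involution: "s \<in> generators \<Longrightarrow> s \<otimes>\<^bsub>RBijGroup \<X>\<^esub> s = \<one>\<^bsub>RBijGroup \<X>\<^esub>"
proof -
  have closed: "f x v \<in> \<X>" and invol: "f x (f x v) = v"
    if "f \<in> {act0, act1, act2}" "v \<in> \<X>" for f x v
  proof -
    have "f x v \<in> \<X> \<and> f x (f x v) = v"
      using that(2)
      by (cases rule: \<X>_cases; insert that)
        (auto simp: act0_closed act0_involution act1_simps act2_simps \<X>_Cons)
    then show "f x v \<in> \<X>" "f x (f x v) = v"
      by simp_all
  qed
  have *: "restrict (f x) \<X> \<in> Bij \<X>" if "f \<in> {act0, act1, act2}" for f x
    unfolding Bij_def using closed[OF that] invol[OF that]
    by (auto intro!: bij_betw_byWitness[where f' = "f x"])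
  then show subset: "generators \<subseteq> carrier (RBijGroup \<X>)"
    unfolding generators_def RBijGroup_def BijGroup_def by fastforce
  assume "s \<in> generators"
  then obtain f x where f: "f \<in> {act0, act1, act2}" and s: "s = restrict (f x) \<X>"
    by (auto simp: generators_def)
  have "compose \<X> s s = (\<lambda>v\<in>\<X>. v)"
    unfolding s using closed[OF f] invol[OF f] by (auto simp: compose_def fun_eq_iff)
  then show "s \<otimes>\<^bsub>RBijGroup \<X>\<^esub> s = \<one>\<^bsub>RBijGroup \<X>\<^esub>"
    using *[OF f, of x] by (simp add: RBijGroup_def BijGroup_def s)
qed

lemma group_\<G>: "group \<G>"
  unfolding \<G>_def
  by (intro group.subgroup_imp_group group.generate_is_subgroup group_RBijGroup generators_subset)

lemma finite_generators: "finite generators"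
proof -
  have "(UNIV :: label set) = {La, Lb, Lc, Ld}"
    using label.exhaust by auto
  then have "finite (UNIV :: label set)"
    by (metis finite.emptyI finite_insert)
  moreover have "generators = (\<lambda>(f, x). restrict (f x) \<X>) ` ({act0, act1, act2} \<times> UNIV)"
    by (auto simp: generators_def)
  ultimately show ?thesis
    by (metis finite.emptyI finite_SigmaI finite_imageI finite_insert)
qed

lemma \<G>_word:
  assumes "g \<in> carrier \<G>"
  shows "\<exists>ws. set ws \<subseteq> generators \<and> foldr (\<lambda>s h. s \<otimes>\<^bsub>\<G>\<^esub> h) ws \<one>\<^bsub>\<G>\<^esub> = g"
proof -
  interpret R: group "RBijGroup \<X>" by (rule group_RBijGroup)
  let ?p = "\<lambda>ws. foldr (\<lambda>s h. s \<otimes>\<^bsub>RBijGroup \<X>\<^esub> h) ws \<one>\<^bsub>RBijGroup \<X>\<^esub>"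
  have closed: "?p ws \<in> carrier (RBijGroup \<X>)" if "set ws \<subseteq> generators" for ws
    using that generators_subset by (induction ws) auto
  have append: "?p (us @ ws) = ?p us \<otimes>\<^bsub>RBijGroup \<X>\<^esub> ?p ws"
    if "set us \<subseteq> generators" "set ws \<subseteq> generators" for us ws
    using that(1)
  proof (induction us)
    case (Cons u us)
    then show ?case
      using closed that(2) generators_subset by (auto simp: R.m_assoc subset_iff)
  qed (simp add: closed that)
  have "g \<in> generate (RBijGroup \<X>) generators"
    using assms by (simp add: \<G>_def)
  then have "\<exists>ws. set ws \<subseteq> generators \<and> ?p ws = g"
  proof (induction rule: generate.induct)
    case one
    show ?case by (intro exI[of _ "[]"]) simp
  next
    case (incl h)
    then show ?case
      using generators_subset by (intro exI[of _ "[h]"]) auto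
  next
    case (inv h)
    then have "inv\<^bsub>RBijGroup \<X>\<^esub> h = h"
      using generators_involution generators_subset by (intro R.inv_equality) auto
    then show ?case
      using inv generators_subset by (intro exI[of _ "[h]"]) auto
  next
    case (eng g h)
    then obtain us ws where "set us \<subseteq> generators" "?p us = g" "set ws \<subseteq> generators" "?p ws = h"
      by blast
    then show ?case
      using append by (intro exI[of _ "us @ ws"]) auto
  qed
  then show ?thesis
    by (simp add: \<G>_def)
qed

lemma finite_ball: "finite {g \<in> carrier \<G>. real (word_length \<G> generators g) \<le> R}"
proof -
  let ?p = "\<lambda>ws. foldr (\<lambda>s h. s \<otimes>\<^bsub>\<G>\<^esub> h) ws \<one>\<^bsub>\<G>\<^esub>"
  have "{g \<in> carrier \<G>. real (word_length \<G> generators g) \<le> R}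
      \<subseteq> ?p ` {ws. set ws \<subseteq> generators \<and> length ws \<le> nat \<lfloor>R\<rfloor>}"
  proof
    fix g assume g: "g \<in> {g \<in> carrier \<G>. real (word_length \<G> generators g) \<le> R}"
    then have "\<exists>l ws. length ws = l \<and> set ws \<subseteq> generators \<and> ?p ws = g"
      using \<G>_word[of g] by auto
    from LeastI_ex[OF this] obtain ws
      where "length ws = word_length \<G> generators g" "set ws \<subseteq> generators" "?p ws = g"
      unfolding word_length_def by blast
    moreover from this(1) g have "length ws \<le> nat \<lfloor>R\<rfloor>"
      by (simp add: le_nat_floor)
    ultimately show "g \<in> ?p ` {ws. set ws \<subseteq> generators \<and> length ws \<le> nat \<lfloor>R\<rfloor>}"
      by blast
  qed
  then show ?thesis
    using finite_lists_length_le[OF finite_generators] finite_surj by blast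
qed

end

theory Submission
  imports Defs "HOL-Library.While_Combinator"
begin

text \<open>The orbital graphs of \<open>G\<close> are lines, and removing the edges on which a generator acts
  through a restriction to a deeper tail cuts them into tiles: the points with tail \<open>v\<close> after three
  letters form a path with five vertices \<open>010, 000, 100, 101, 001\<close> if \<open>v\<close> starts with \<open>0\<close>, and with
  the three vertices \<open>010, 000, 100\<close> if \<open>v\<close> starts with \<open>1\<close>. Collapsing every tile to its tail \<open>v\<close> gives
  back the same orbital graphs, with labels shifted along \<open>b \<rightarrow> c \<rightarrow> d \<rightarrow> b\<close>. Hence the movement of
  points under a word of length \<open>R\<close> can be recorded, level by level, by the traverses of tiles,
  together with the element of the Klein four-group \<open>{1, b, c, d}\<close> accumulated between two
  traverses. Since on every third level a letter does not cross the edge it labels, a weighted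
  number of traverses shrinks by the factor \<open>6/7\<close> per level, while the number of vertices of a
  tile grows at most by the factor \<open>5\<close>. At the level \<open>k\<close> where \<open>(6/7)^k * R\<close> and \<open>5^k\<close> balance,
  an element is therefore described by \<open>O(R powr (11/12))\<close> items, each with polynomially many values.\<close>

section \<open>The action on tiles\<close>

datatype index = I0 | I1 | I2

datatype pos = P010 | P000 | P100 | P101 | P001

fun word :: "pos \<Rightarrow> bit list" where
  "word P010 = [0, 1, 0]"
| "word P000 = [0, 0, 0]"
| "word P100 = [1, 0, 0]"
| "word P101 = [1, 0, 1]"
| "word P001 = [0, 0, 1]"

definition first_bit :: "pos \<Rightarrow> bit" where
  "first_bit p = hd (word p)"

definition tile :: "bit \<Rightarrow> pos set" where
  "tile t = (if t = 0 then UNIV else {P010, P000, P100})"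

text \<open>\<open>None\<close> is the trivial letter. It has a place here because \<open>a\<close>
  restricts to the identity and equal labels cancel when multiplied.\<close>

fun act :: "index \<Rightarrow> label option \<Rightarrow> bit stream \<Rightarrow> bit stream" where
  "act i None v = v"
| "act I0 (Some x) v = act0 x v"
| "act I1 (Some x) v = act1 x v"
| "act I2 (Some x) v = act2 x v"

definition flips :: "label option \<Rightarrow> bool" where
  "flips y \<longleftrightarrow> y \<in> {Some La, Some Lb, Some Lc}"

definition next_label :: "label option \<Rightarrow> label option" where
  "next_label y = Option.bind y successor"

text \<open>These are the ends of a tile, where a letter acts on the tail instead of moving the
  position: \<open>P010\<close> in both shapes, \<open>P001\<close> in the five-vertex tile,
  \<open>P100\<close> in the three-vertex tile. For \<open>I1\<close> the shape is implicit, as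
  \<open>P001\<close> occurs only in \<open>tile 0\<close>.\<close>

fun special :: "bit \<Rightarrow> index \<Rightarrow> pos \<Rightarrow> bool" where
  "special t I0 p \<longleftrightarrow> p = P010"
| "special t I1 p \<longleftrightarrow> p = P001"
| "special t I2 p \<longleftrightarrow> p = P100 \<and> t = 1"

fun swap :: "pos \<Rightarrow> pos \<Rightarrow> pos \<Rightarrow> pos" where
  "swap p q r = (if r = p then q else if r = q then p else r)"

text \<open>The path is \<open>P010\<close> -\<open>I1\<close>- \<open>P000\<close>
  -\<open>I0\<close>- \<open>P100\<close> -\<open>I2\<close>- \<open>P101\<close>
  -\<open>I0\<close>- \<open>P001\<close>; for \<open>t = 1\<close> it stops at
  \<open>P100\<close>.\<close>

fun move :: "bit \<Rightarrow> index \<Rightarrow> pos \<Rightarrow> pos" where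
  "move t I0 p = swap P000 P100 (swap P101 P001 p)"
| "move t I1 p = swap P010 P000 p"
| "move t I2 p = (if t = 0 then swap P100 P101 p else p)"

definition mv :: "bit \<Rightarrow> index \<Rightarrow> label option \<Rightarrow> pos \<Rightarrow> pos" where
  "mv t i y p = (if flips y then move t i p else p)"

lemma index_UNIV: "(UNIV :: index set) = {I0, I1, I2}"
  using index.exhaust by auto

lemma label_option_UNIV: "(UNIV :: label option set) = {None, Some La, Some Lb, Some Lc, Some Ld}"
proof -
  have "y \<in> {None, Some La, Some Lb, Some Lc, Some Ld}" for y :: "label option"
  proof (cases y)
    case (Some x)
    then show ?thesis by (cases x) auto
  qed auto
  then show ?thesis by blast
qed

lemma act_closed:
  assumes "v \<in> \<X>"
  shows "act i y v \<in> \<X>"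
proof (cases y)
  case (Some x)
  from assms show ?thesis
    by (cases rule: \<X>_cases; cases i)
      (use Some assms in \<open>auto simp: act0_closed act1_simps act2_simps \<X>_Cons\<close>)
qed (use assms in simp)

lemma shd_act:
  assumes "v \<in> \<X>" "i \<noteq> I0"
  shows "shd (act i y v) = shd v"
proof (cases y)
  case (Some x)
  from assms(1) show ?thesis
    by (cases rule: \<X>_cases; cases i)
      (use Some assms in \<open>auto simp: act1_simps act2_simps\<close>)
qed simp

lemma tile_decomposition:
  assumes "x \<in> \<X>"
  obtains p v where "x = word p @- v" "v \<in> \<X>" "p \<in> tile (shd v)" "shd x = first_bit p"
proof -
  obtain a b c v where v: "x = a ## b ## c ## v"
    by (metis stream.collapse)
  have *: "v \<in> \<X>" "\<not> (c = 1 \<and> shd v = 1)" "\<not> (b = 1 \<and> c = 1)" "\<not> (a = 1 \<and> b = 1)"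
    using assms unfolding v by (auto simp: \<X>_Cons)
  define p where "p = (if a = 1 then if c = 1 then P101 else P100
    else if b = 1 then P010 else if c = 1 then P001 else P000)"
  have "x = word p @- v" "p \<in> tile (shd v)" "shd x = first_bit p"
    using * unfolding v p_def
    by (cases a; cases b; cases c; cases "shd v"; simp add: tile_def first_bit_def)+
  with *(1) that show thesis by blast
qed

lemma tile_in_X:
  assumes "v \<in> \<X>" "p \<in> tile (shd v)"
  shows "word p @- v \<in> \<X>"
  using assms by (cases p) (auto simp: \<X>_Cons tile_def split: if_splits)

text \<open>In each case the generator meets a block \<open>010\<close>, formed by the end of the
  position and, for \<open>I1\<close> and \<open>I2\<close>, the start of \<open>v\<close>. The
  recursive rule past \<open>010\<close> shifts the label.\<close>

lemma act_special:
  assumes v: "v \<in> \<X>" and p: "p \<in> tile (shd v)" and s: "special (shd v) i p"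
  shows "act i y (word p @- v) = word p @- act i (next_label y) v"
proof (cases y)
  case (Some x)
  show ?thesis
  proof (cases i)
    case I0
    then show ?thesis using s Some
      by (cases x) (auto simp: act0_010 next_label_def)
  next
    case I1
    with p s have "p = P001" "shd v = 0"
      by (auto simp: tile_def split: if_splits)
    then obtain u where "v = 0 ## u" by (metis stream.collapse)
    with I1 Some \<open>p = P001\<close> show ?thesis
      by (cases x) (auto simp: act1_simps act0_010 next_label_def)
  next
    case I2
    with s have s': "p = P100" "shd v = 1"
      by auto
    from v obtain u where "v = 1 ## 0 ## u"
      by (cases rule: \<X>_cases) (use s' in auto)
    with I2 Some s' show ?thesis
      by (cases x) (auto simp: act2_simps act0_010 next_label_def)
  qed
qed (simp add: next_label_def)

lemma act_move:
  assumes v: "v \<in> \<X>" and p: "p \<in> tile (shd v)" and s: "\<not> special (shd v) i p"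
  shows "act i y (word p @- v) = word (mv (shd v) i y p) @- v"
proof (cases y)
  case (Some x)
  from v show ?thesis
    by (cases rule: \<X>_cases; cases i; cases p; cases x)
      (use p s Some in \<open>auto simp: tile_def mv_def flips_def
        act0_00 act0_10 act0_010 act1_simps act2_simps\<close>)
qed (simp add: mv_def flips_def)

lemma mv_in_tile: "p \<in> tile t \<Longrightarrow> mv t i y p \<in> tile t"
  by (cases i; cases t) (auto simp: tile_def mv_def)

lemma mv_mv: "mv t i y (mv t i y p) = p"
  by (cases i; cases t; cases p) (auto simp: mv_def)

lemma mv_special: "special t i p \<Longrightarrow> mv t i y p = p"
  by (cases i; cases t; cases p) (auto simp: mv_def)

lemma first_bit_mv: "i \<noteq> I0 \<Longrightarrow> first_bit (mv t i y p) = first_bit p"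
  by (cases i; cases t; cases p) (auto simp: mv_def first_bit_def)

lemma inj_word: "inj word"
proof (rule injI)
  fix p q assume "word p = word q" then show "p = q" by (cases p; cases q) auto
qed

lemma length_word [simp]: "length (word p) = 3"
  by (cases p) auto

text \<open>On \<open>None\<close>, \<open>b\<close>, \<open>c\<close>, \<open>d\<close> this is the Klein four-group; values involving \<open>a\<close> are junk.\<close>

fun label_mult :: "label option \<Rightarrow> label option \<Rightarrow> label option" where
  "label_mult None y = y"
| "label_mult x None = x"
| "label_mult (Some x) (Some y) =
     (if x = y then None else if Lb \<notin> {x, y} then Some Lb
      else if Lc \<notin> {x, y} then Some Lc else Some Ld)"

text \<open>Streams are compared coordinatewise, because the recursion past \<open>010\<close>
  lowers the index by three. On \<open>00\<close> and \<open>10\<close> the labels \<open>b\<close>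
  and \<open>c\<close> flip and \<open>d\<close> does not; past \<open>010\<close> the cyclic shift
  by \<open>successor\<close> is compatible with \<open>label_mult\<close>.\<close>

lemma act0_act0:
  assumes "v \<in> \<X>" "x \<noteq> La" "y \<noteq> La"
  shows "act0 y (act0 x v) = act I0 (label_mult (Some x) (Some y)) v"
proof -
  have "act0 y (act0 x v) !! n = act I0 (label_mult (Some x) (Some y)) v !! n" for n
    using assms
  proof (induction n arbitrary: x y v rule: less_induct)
    case (less n)
    from less.prems(1) show ?case
    proof (cases rule: \<X>_cases)
      case (3 w)
      have IH: "act0 y (act0 x w) !! m = act I0 (label_mult (Some x) (Some y)) w !! m"
        if "n = Suc (Suc (Suc m))" "x \<noteq> La" "y \<noteq> La" for x y m
        using less.IH[of m w x y] that 3 by simp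
      consider "n = 0" | "n = Suc 0" | "n = Suc (Suc 0)" | m where "n = Suc (Suc (Suc m))"
        by (metis not0_implies_Suc)
      then show ?thesis
        using IH 3 less.prems by cases (cases x; cases y; simp add: act0_010)+
    qed (cases x; cases y; use less.prems in \<open>simp add: act0_00 act0_10\<close>)+
  qed
  then show ?thesis
    by (metis stream_smap_nats stream.map_cong0 ext)
qed

text \<open>\<open>I1\<close> and \<open>I2\<close> either act as \<open>I0\<close> behind a fixed
  prefix or trivially, so the product rule for \<open>I0\<close> carries over.\<close>

lemma act_act:
  assumes v: "v \<in> \<X>" and "x \<noteq> Some La" "y \<noteq> Some La"
  shows "act i y (act i x v) = act i (label_mult x y) v"
proof (cases "x = None \<or> y = None")
  case True
  then show ?thesis by (cases x) auto
next
  case False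
  then obtain a b where xy: "x = Some a" "y = Some b" by auto
  then have ab: "a \<noteq> La" "b \<noteq> La" using assms by auto
  have 0: "act I0 y (act I0 x u) = act I0 (label_mult x y) u" if "u \<in> \<X>" for u
    using act0_act0[OF that ab] xy by simp
  have 1: "act I1 z (0 ## w) = 0 ## act I0 z w" "act I1 z (1 ## w) = 1 ## w" for z w
    by (cases z; simp add: act1_def)+
  have 2: "act I2 z (1 ## 0 ## w) = 1 ## 0 ## act I0 z w" "act I2 z (0 ## w) = 0 ## w" for z w
    by (cases z; simp add: act2_simps)+
  show ?thesis
    using v
    by (cases rule: \<X>_cases; cases i)
      (simp_all add: 0 1 2 v \<X>_Cons del: act.simps label_mult.simps)
qed

section \<open>First returns of injective maps\<close>

lemma while_funpow:
  assumes "k \<le> n" "E ((f ^^ n) z)" "\<And>j. k \<le> j \<Longrightarrow> j < n \<Longrightarrow> \<not> E ((f ^^ j) z)"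
  shows "while (\<lambda>x. \<not> E x) f ((f ^^ k) z) = (f ^^ n) z"
  using assms(1,3)
proof (induction k rule: inc_induct)
  case base
  then show ?case using assms(2) by (subst while_unfold) simp
next
  case (step m)
  then have "\<not> E ((f ^^ m) z)" by simp
  then have "while (\<lambda>x. \<not> E x) f ((f ^^ m) z) = while (\<lambda>x. \<not> E x) f ((f ^^ Suc m) z)"
    by (subst while_unfold) simp
  with step show ?case by simp
qed

lemma funpow_closed:
  assumes "f ` Z \<subseteq> Z" "z \<in> Z"
  shows "(f ^^ k) z \<in> Z"
  by (induction k) (use assms in auto)

lemma funpow_cancel:
  assumes "inj_on f Z" "f ` Z \<subseteq> Z" "x \<in> Z" "y \<in> Z" "(f ^^ i) x = (f ^^ i) y"
  shows "x = y"
  using assms(5)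
proof (induction i)
  case (Suc i)
  then show ?case
    using assms funpow_closed[OF assms(2)] by (simp add: inj_on_eq_iff)
qed simp

text \<open>An injective self-map of a finite set has only cycles, so \<open>z\<close> comes back to
  itself and hence to \<open>E\<close>; \<open>n\<close> is the least positive return time.\<close>

lemma first_return:
  assumes "finite Z" "inj_on f Z" "f ` Z \<subseteq> Z" "z \<in> Z" "E z"
  obtains n where "n > 0" "while (\<lambda>x. \<not> E x) f (f z) = (f ^^ n) z" "E ((f ^^ n) z)"
    "\<And>j. 0 < j \<Longrightarrow> j < n \<Longrightarrow> \<not> E ((f ^^ j) z)"
proof -
  have "\<not> inj (\<lambda>k. (f ^^ k) z)"
  proof
    assume "inj (\<lambda>k. (f ^^ k) z)"
    moreover have "range (\<lambda>k. (f ^^ k) z) \<subseteq> Z"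
      using funpow_closed[OF assms(3,4)] by blast
    ultimately show False
      using assms(1) finite_imageD finite_subset infinite_UNIV_nat by blast
  qed
  then obtain i j where ij: "i < j" "(f ^^ i) z = (f ^^ j) z"
    by (metis (mono_tags, lifting) injI linorder_neqE_nat)
  have "(f ^^ j) z = (f ^^ i) ((f ^^ (j - i)) z)"
    using funpow_add[of i "j - i" f] ij(1) by simp
  with ij(2) have "(f ^^ i) z = (f ^^ i) ((f ^^ (j - i)) z)"
    by simp
  then have "z = (f ^^ (j - i)) z"
    using funpow_cancel[OF assms(2,3,4) funpow_closed[OF assms(3,4)]] by blast
  then have ex: "\<exists>k. k > 0 \<and> E ((f ^^ k) z)"
    using ij assms(5) by (metis zero_less_diff)
  define n where "n = (LEAST k. k > 0 \<and> E ((f ^^ k) z))"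
  have n: "n > 0" "E ((f ^^ n) z)"
    using LeastI_ex[OF ex] unfolding n_def by auto
  have l: "\<not> E ((f ^^ j) z)" if "0 < j" "j < n" for j
    using not_less_Least[of j "\<lambda>k. k > 0 \<and> E ((f ^^ k) z)"] that unfolding n_def by blast
  have "while (\<lambda>x. \<not> E x) f ((f ^^ 1) z) = (f ^^ n) z"
    by (rule while_funpow) (use n l in auto)
  with n l that show thesis by simp
qed

text \<open>If two first returns coincide, cancelling the smaller time puts one starting point on
  the excursion of the other, \<open>n - m\<close> steps after its start. Being in \<open>E\<close>,
  it forces \<open>m = n\<close>.\<close>

lemma inj_on_first_return:
  assumes "finite Z" "inj_on f Z" "f ` Z \<subseteq> Z"
  shows "inj_on (\<lambda>z. while (\<lambda>x. \<not> E x) f (f z)) {z \<in> Z. E z}"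
proof (rule inj_onI)
  fix x y
  assume x: "x \<in> {z \<in> Z. E z}" and y: "y \<in> {z \<in> Z. E z}"
    and eq: "while (\<lambda>x. \<not> E x) f (f x) = while (\<lambda>x. \<not> E x) f (f y)"
  have *: "a = b" if a: "a \<in> Z" "E a" and b: "b \<in> Z" "E b" and eq: "(f ^^ m) a = (f ^^ n) b"
    and "m \<le> n" "0 < m" and n: "\<And>j. 0 < j \<Longrightarrow> j < n \<Longrightarrow> \<not> E ((f ^^ j) b)" for a b m n
  proof -
    have "(f ^^ m) a = (f ^^ m) ((f ^^ (n - m)) b)"
      using eq \<open>m \<le> n\<close> funpow_add[of m "n - m" f] by simp
    then have ab: "a = (f ^^ (n - m)) b"
      using funpow_cancel[OF assms(2,3) a(1) funpow_closed[OF assms(3) b(1)]] by blast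
    show "a = b"
      using n[of "n - m"] ab a(2) \<open>0 < m\<close> \<open>m \<le> n\<close> by (cases "m = n") auto
  qed
  obtain m where m: "m > 0" "while (\<lambda>x. \<not> E x) f (f x) = (f ^^ m) x"
    "\<And>j. 0 < j \<Longrightarrow> j < m \<Longrightarrow> \<not> E ((f ^^ j) x)"
    using first_return[OF assms, of x E] x by blast
  obtain n where n: "n > 0" "while (\<lambda>x. \<not> E x) f (f y) = (f ^^ n) y"
    "\<And>j. 0 < j \<Longrightarrow> j < n \<Longrightarrow> \<not> E ((f ^^ j) y)"
    using first_return[OF assms, of y E] y by blast
  show "x = y"
    using *[of x y m n] *[of y x n m] x y eq m n by (cases "m \<le> n") auto
qed

section \<open>Machines\<close>

text \<open>A vertex \<open>w @- v\<close> of an orbital graph lies in the level-\<open>n\<close> tile of \<open>v\<close> at position \<open>w\<close>,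
  where \<open>w\<close> has length \<open>3 * n\<close> and the shape of the tile depends on the first letter of \<open>v\<close>.
  A machine describes how a group element moves the points: a point enters its tile at \<open>Wd w\<close>,
  is carried inside tiles to states at which a letter acts on \<open>v\<close>, and finally halts
  at some \<open>Wd w'\<close>. The next node depends on the first letter of the current \<open>v\<close>.\<close>

datatype node = St nat | Wd "bit list"

record machine =
  states :: "bit \<Rightarrow> nat set"
  idx :: "nat \<Rightarrow> index"
  lab :: "nat \<Rightarrow> label option"
  nxt :: "node \<Rightarrow> bit \<Rightarrow> node"

text \<open>The three letters next to the tail are appended on the right. They begin the tail of the
  lower level, so their first bit selects the shape of the lower tile.\<close>

fun words :: "nat \<Rightarrow> bit \<Rightarrow> bit list set" where
  "words 0 t = {[]}"
| "words (Suc n) t = (\<Union>p\<in>tile t. (\<lambda>w. w @ word p) ` words n (first_bit p))"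

definition nodes :: "nat \<Rightarrow> machine \<Rightarrow> bit \<Rightarrow> node set" where
  "nodes n M t = St ` states M t \<union> Wd ` words n t"

text \<open>For each first letter \<open>t\<close> of the tail, the steps permute a finite set of
  nodes. A letter of index \<open>I0\<close> can change that first letter, so its state must occur
  for both values.\<close>

definition valid :: "nat \<Rightarrow> machine \<Rightarrow> bool" where
  "valid n M \<longleftrightarrow>
     (\<forall>t. finite (states M t) \<and> inj_on (\<lambda>e. nxt M e t) (nodes n M t) \<and>
          (\<forall>e\<in>nodes n M t. nxt M e t \<in> nodes n M t)) \<and>
     (\<forall>q. idx M q = I0 \<longrightarrow> (q \<in> states M 0 \<longleftrightarrow> q \<in> states M 1))"

text \<open>This is the situation after a renormalization: \<open>I1\<close> exits only from
  five-vertex tiles, \<open>I2\<close> only from three-vertex tiles, and \<open>a\<close> has become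
  trivial.\<close>

definition proper :: "machine \<Rightarrow> bool" where
  "proper M \<longleftrightarrow> (\<forall>q\<in>states M 0. idx M q \<noteq> I2) \<and> (\<forall>q\<in>states M 1. idx M q \<noteq> I1) \<and>
     (\<forall>t. \<forall>q\<in>states M t. lab M q \<noteq> Some La)"

fun letter :: "machine \<Rightarrow> node \<Rightarrow> index \<times> label option" where
  "letter M (St q) = (idx M q, lab M q)"
| "letter M (Wd w) = (I0, None)"

definition effect :: "machine \<Rightarrow> node \<Rightarrow> bit stream \<Rightarrow> bit stream" where
  "effect M e v = act (fst (letter M e)) (snd (letter M e)) v"

text \<open>The letter of the current node acts first; the first letter of the new tail then selects
  the next node. Only halting runs are derivable.\<close>

inductive runs :: "machine \<Rightarrow> node \<Rightarrow> bit stream \<Rightarrow> bit list \<Rightarrow> bit stream \<Rightarrow> bool" for M where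
  halt: "runs M e v w (effect M e v)" if "nxt M e (shd (effect M e v)) = Wd w"
| continue: "runs M e v w v'" if "nxt M e (shd (effect M e v)) = St q" "runs M (St q) (effect M e v) w v'"

definition represents :: "nat \<Rightarrow> machine \<Rightarrow> (bit stream \<Rightarrow> bit stream) \<Rightarrow> bool" where
  "represents n M g \<longleftrightarrow> (\<forall>v\<in>\<X>. \<forall>w\<in>words n (shd v).
     \<exists>w' v'. runs M (Wd w) v w' v' \<and> g (w @- v) = w' @- v')"

section \<open>Tile words, and machine steps as permutations of nodes\<close>

lemma UNIV_pos: "UNIV = {P010, P000, P100, P101, P001}"
proof -
  have "p \<in> {P010, P000, P100, P101, P001}" for p
    by (cases p) simp_all
  then show ?thesis by blast
qed

lemma finite_tile [simp]: "finite (tile t)"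
  by (simp add: tile_def UNIV_pos)

lemma card_tile_le: "card (tile t) \<le> 5"
  by (simp add: tile_def UNIV_pos)

lemma finite_words [simp]: "finite (words n t)"
  by (induction n arbitrary: t) auto

lemma card_words_le: "card (words n t) \<le> 5 ^ n"
proof (induction n arbitrary: t)
  case (Suc n)
  have "card (words (Suc n) t) \<le> (\<Sum>p\<in>tile t. card ((\<lambda>w. w @ word p) ` words n (first_bit p)))"
    unfolding words.simps by (rule card_UN_le) simp
  also have "\<dots> \<le> (\<Sum>p\<in>tile t. 5 ^ n)"
    by (intro sum_mono order_trans[OF card_image_le Suc.IH]) simp
  also have "\<dots> \<le> 5 ^ Suc n"
    using card_tile_le[of t] by simp
  finally show ?case .
qed simp

lemma length_words: "w \<in> words n t \<Longrightarrow> length w = 3 * n"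
  by (induction n arbitrary: t w) auto

lemma words_decomposition:
  assumes "x \<in> \<X>"
  obtains w v where "x = w @- v" "v \<in> \<X>" "w \<in> words n (shd v)"
proof -
  have "\<exists>w v. x = w @- v \<and> v \<in> \<X> \<and> w \<in> words n (shd v)"
  proof (induction n)
    case 0
    show ?case using assms by (intro exI[of _ "[]"] exI[of _ x]) simp
  next
    case (Suc n)
    then obtain w v where v: "x = w @- v" "v \<in> \<X>" "w \<in> words n (shd v)" by blast
    obtain p u where "v = word p @- u" "u \<in> \<X>" "p \<in> tile (shd u)" "shd v = first_bit p"
      using tile_decomposition[OF v(2)] .
    with v show ?case
      by (intro exI[of _ "w @ word p"] exI[of _ u]) auto
  qed
  with that show thesis by blast
qed

lemma finite_nodes: "valid n M \<Longrightarrow> finite (nodes n M t)"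
  by (simp add: valid_def nodes_def)

lemma effect_St [simp]: "effect M (St q) v = act (idx M q) (lab M q) v"
  and effect_Wd [simp]: "effect M (Wd w) v = v"
  by (simp_all add: effect_def)

lemma St_in_nodes [simp]: "St q \<in> nodes n M t \<longleftrightarrow> q \<in> states M t"
  and Wd_in_nodes [simp]: "Wd w \<in> nodes n M t \<longleftrightarrow> w \<in> words n t"
  by (auto simp: nodes_def)

lemma states_I0:
  assumes "valid n M" "idx M q = I0" "q \<in> states M t"
  shows "q \<in> states M t'"
proof -
  have "q \<in> states M 0 \<longleftrightarrow> q \<in> states M 1"
    using assms(1,2) unfolding valid_def by blast
  with assms(3) show ?thesis
    by (cases t; cases t') simp_all
qed

lemma nodes_effect:
  assumes "valid n M" "e \<in> nodes n M (shd v)" "v \<in> \<X>"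
  shows "e \<in> nodes n M (shd (effect M e v))"
proof (cases e)
  case [simp]: (St q)
  show ?thesis
  proof (cases "idx M q = I0")
    case True
    then show ?thesis using states_I0[OF assms(1) True] assms(2) by simp
  next
    case False
    then show ?thesis using assms(2) by (simp add: shd_act[OF assms(3)])
  qed
next
  case (Wd w)
  then show ?thesis using assms(2) by simp
qed

lemma effect_closed: "v \<in> \<X> \<Longrightarrow> effect M e v \<in> \<X>"
  by (simp add: effect_def act_closed)

lemma nxt_closed: "valid n M \<Longrightarrow> e \<in> nodes n M t \<Longrightarrow> nxt M e t \<in> nodes n M t"
  unfolding valid_def by blast

lemma inj_nxt: "valid n M \<Longrightarrow> inj_on (\<lambda>e. nxt M e t) (nodes n M t)"
  unfolding valid_def by blast

lemma nxt_inj: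
  "valid n M \<Longrightarrow> nxt M e t = nxt M e' t \<Longrightarrow> e \<in> nodes n M t \<Longrightarrow> e' \<in> nodes n M t \<Longrightarrow> e = e'"
  using inj_onD[OF inj_nxt] by blast

lemma nxt_surj:
  assumes "valid n M" "e \<in> nodes n M t"
  obtains e' where "e' \<in> nodes n M t" "nxt M e' t = e"
proof -
  have "(\<lambda>e. nxt M e t) ` nodes n M t = nodes n M t"
    by (rule endo_inj_surj[OF finite_nodes[OF assms(1)] _ inj_nxt[OF assms(1)]])
      (auto intro: nxt_closed[OF assms(1)])
  then have "e \<in> (\<lambda>e. nxt M e t) ` nodes n M t"
    using assms(2) by simp
  with that show thesis by blast
qed

section \<open>Renormalization\<close>

text \<open>\<open>special\<close> pins the position to this vertex, so \<open>collapse\<close> can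
  forget it and \<open>expand\<close> can restore it.\<close>

fun home :: "index \<Rightarrow> pos" where
  "home I0 = P010"
| "home I1 = P001"
| "home I2 = P100"

text \<open>The walk inside a tile of fixed shape \<open>t\<close>. At an exit \<open>mv\<close> is
  trivial, so a step from there only follows \<open>nxt\<close>: the letter counts as having acted
  on the deeper tail already.\<close>

fun tile_step :: "machine \<Rightarrow> bit \<Rightarrow> node \<times> pos \<Rightarrow> node \<times> pos" where
  "tile_step M t (St q, p) =
     (let p' = mv t (idx M q) (lab M q) p in (nxt M (St q) (first_bit p'), p'))"
| "tile_step M t (Wd w, p) = (nxt M (Wd w) (first_bit p), p)"

fun exits :: "machine \<Rightarrow> bit \<Rightarrow> node \<times> pos \<Rightarrow> bool" where
  "exits M t (St q, p) \<longleftrightarrow> special t (idx M q) p"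
| "exits M t (Wd w, p) \<longleftrightarrow> True"

fun collapse :: "node \<times> pos \<Rightarrow> node" where
  "collapse (St q, p) = St q"
| "collapse (Wd w, p) = Wd (w @ word p)"

fun expand :: "machine \<Rightarrow> node \<Rightarrow> node \<times> pos" where
  "expand M (St q) = (St q, home (idx M q))"
| "expand M (Wd u) = (Wd (take (length u - 3) u), inv_into UNIV word (drop (length u - 3) u))"

definition first_exit :: "machine \<Rightarrow> bit \<Rightarrow> node \<times> pos \<Rightarrow> node \<times> pos" where
  "first_exit M t = while (\<lambda>z. \<not> exits M t z) (tile_step M t)"

text \<open>The transitions form the first-return map of \<open>tile_step\<close> to the exits.
  State names are kept, so later states still lie below the length of the initial word.\<close>

definition renorm :: "machine \<Rightarrow> machine" where
  "renorm M =
     \<lparr>states = (\<lambda>t. {q \<in> states M (first_bit (home (idx M q))).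
        home (idx M q) \<in> tile t \<and> special t (idx M q) (home (idx M q))}),
      idx = idx M, lab = next_label \<circ> lab M,
      nxt = (\<lambda>e t. collapse (first_exit M t (tile_step M t (expand M e))))\<rparr>"

definition tile_nodes :: "nat \<Rightarrow> machine \<Rightarrow> bit \<Rightarrow> (node \<times> pos) set" where
  "tile_nodes n M t = {(e, p). p \<in> tile t \<and> e \<in> nodes n M (first_bit p)}"

lemma idx_renorm [simp]: "idx (renorm M) = idx M"
  and lab_renorm [simp]: "lab (renorm M) q = next_label (lab M q)"
  and nxt_renorm: "nxt (renorm M) e t = collapse (first_exit M t (tile_step M t (expand M e)))"
  and states_renorm: "states (renorm M) t = {q \<in> states M (first_bit (home (idx M q))).
        home (idx M q) \<in> tile t \<and> special t (idx M q) (home (idx M q))}"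
  by (simp_all add: renorm_def)

lemma first_bit_simps [simp]:
  "first_bit P010 = 0" "first_bit P000 = 0" "first_bit P001 = 0"
  "first_bit P100 = 1" "first_bit P101 = 1"
  by (simp_all add: first_bit_def)

lemma special_home: "special t i p \<Longrightarrow> p = home i"
  by (cases i) auto

lemma inv_word [simp]: "inv_into UNIV word (word p) = p"
  by (rule inv_f_f[OF inj_word])

lemma expand_collapse: "exits M t z \<Longrightarrow> expand M (collapse z) = z"
  by (cases "(M, t, z)" rule: exits.cases) (auto dest: special_home)

lemma exits_expand:
  assumes "e \<in> nodes (Suc n) (renorm M) t"
  shows "expand M e \<in> tile_nodes n M t" "exits M t (expand M e)" "collapse (expand M e) = e"
  using assms by (cases e; auto simp: states_renorm tile_nodes_def)+

lemma collapse_in_nodes: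
  assumes "z \<in> tile_nodes n M t" "exits M t z"
  shows "collapse z \<in> nodes (Suc n) (renorm M) t"
  using assms
  by (cases "(M, t, z)" rule: exits.cases) (auto simp: states_renorm tile_nodes_def dest: special_home)

lemma finite_tile_nodes: "valid n M \<Longrightarrow> finite (tile_nodes n M t)"
proof -
  assume "valid n M"
  have "tile_nodes n M t \<subseteq> (nodes n M 0 \<union> nodes n M 1) \<times> tile t"
  proof
    fix z assume "z \<in> tile_nodes n M t"
    then show "z \<in> (nodes n M 0 \<union> nodes n M 1) \<times> tile t"
      by (cases z; cases "first_bit (snd z)") (auto simp: tile_nodes_def)
  qed
  then show ?thesis
    using finite_nodes[OF \<open>valid n M\<close>] by (meson finite_SigmaI finite_Un finite_subset finite_tile)
qed

lemma node_mv:
  assumes "valid n M" "St q \<in> nodes n M (first_bit p)"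
  shows "St q \<in> nodes n M (first_bit (mv t (idx M q) y p))"
proof (cases "idx M q = I0")
  case True
  then show ?thesis using states_I0[OF assms(1) True] assms(2) by simp
next
  case False
  then show ?thesis using assms(2) by (simp add: first_bit_mv)
qed

lemma tile_step_closed:
  assumes "valid n M"
  shows "tile_step M t ` tile_nodes n M t \<subseteq> tile_nodes n M t"
proof
  fix z' assume "z' \<in> tile_step M t ` tile_nodes n M t"
  then obtain e p where z: "p \<in> tile t" "e \<in> nodes n M (first_bit p)" "z' = tile_step M t (e, p)"
    by (auto simp: tile_nodes_def)
  show "z' \<in> tile_nodes n M t"
  proof (cases e)
    case (St q)
    with z show ?thesis
      using nxt_closed[OF assms node_mv[OF assms, of q p t "lab M q"]]
      by (simp add: tile_nodes_def Let_def mv_in_tile)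
  next
    case (Wd w)
    with z show ?thesis
      using nxt_closed[OF assms, of e "first_bit p"] by (simp add: tile_nodes_def)
  qed
qed

text \<open>The new position tells which of the two injective maps \<open>nxt\<close> was applied,
  so the old node is recovered; the involution \<open>mv\<close> then recovers the old
  position.\<close>

lemma inj_on_tile_step:
  assumes "valid n M"
  shows "inj_on (tile_step M t) (tile_nodes n M t)"
proof (rule inj_onI)
  fix z z' assume z: "z \<in> tile_nodes n M t" "z' \<in> tile_nodes n M t"
    and eq: "tile_step M t z = tile_step M t z'"
  define next_pos where "next_pos z = (case z of (St q, p) \<Rightarrow> mv t (idx M q) (lab M q) p | (Wd w, p) \<Rightarrow> p)"
    for z :: "node \<times> pos"
  have step: "tile_step M t z = (nxt M (fst z) (first_bit (next_pos z)), next_pos z)" for z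
    by (cases "(M, t, z)" rule: exits.cases) (auto simp: next_pos_def Let_def)
  have mem: "fst z \<in> nodes n M (first_bit (next_pos z))" if "z \<in> tile_nodes n M t" for z
    using that node_mv[OF assms]
    by (cases "(M, t, z)" rule: exits.cases) (auto simp: next_pos_def tile_nodes_def)
  have np: "next_pos z = next_pos z'"
    using eq by (simp add: step)
  then have "nxt M (fst z) (first_bit (next_pos z)) = nxt M (fst z') (first_bit (next_pos z))"
    using eq by (simp add: step)
  then have fst: "fst z = fst z'"
    using mem[OF z(1)] mem[OF z(2)] np nxt_inj[OF assms] by metis
  have "snd z = snd z'"
  proof (cases "fst z")
    case (St q)
    then have "mv t (idx M q) (lab M q) (snd z) = mv t (idx M q) (lab M q) (snd z')"
      using np fst by (cases z; cases z') (auto simp: next_pos_def)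
    then show ?thesis by (metis mv_mv)
  next
    case (Wd w)
    then show ?thesis
      using np fst by (cases z; cases z') (auto simp: next_pos_def)
  qed
  with fst show "z = z'" by (simp add: prod_eq_iff)
qed

lemma renorm_path:
  assumes "valid n M" "e \<in> nodes (Suc n) (renorm M) t"
  obtains k where "k > 0"
    "first_exit M t (tile_step M t (expand M e)) = (tile_step M t ^^ k) (expand M e)"
    "exits M t ((tile_step M t ^^ k) (expand M e))"
    "\<And>j. 0 < j \<Longrightarrow> j < k \<Longrightarrow> \<not> exits M t ((tile_step M t ^^ j) (expand M e))"
  using first_return[where E = "exits M t", OF finite_tile_nodes[OF assms(1)] inj_on_tile_step[OF assms(1)]
      tile_step_closed[OF assms(1)] exits_expand(1,2)[OF assms(2)]]
  unfolding first_exit_def by metis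

lemma path_in_tile_nodes:
  assumes "valid n M" "e \<in> nodes (Suc n) (renorm M) t"
  shows "(tile_step M t ^^ j) (expand M e) \<in> tile_nodes n M t"
  by (rule funpow_closed[OF tile_step_closed[OF assms(1)] exits_expand(1)[OF assms(2)]])

text \<open>First returns of an injective map on a finite set are injective, and
  \<open>expand\<close> inverts \<open>collapse\<close> on exits.\<close>

lemma valid_renorm:
  assumes "valid n M"
  shows "valid (Suc n) (renorm M)"
  unfolding valid_def
proof (intro conjI allI ballI impI)
  fix t
  show "finite (states (renorm M) t)"
  proof (rule finite_subset)
    show "states (renorm M) t \<subseteq> states M 0 \<union> states M 1"
      by (rule subsetI, case_tac "first_bit (home (idx M x))") (auto simp: states_renorm)
    show "finite (states M 0 \<union> states M 1)"
      using assms by (simp add: valid_def)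
  qed
  show closed: "nxt (renorm M) e t \<in> nodes (Suc n) (renorm M) t"
    if e: "e \<in> nodes (Suc n) (renorm M) t" for e
    unfolding nxt_renorm
    using renorm_path[OF assms e] path_in_tile_nodes[OF assms e] collapse_in_nodes by metis
  show "inj_on (\<lambda>e. nxt (renorm M) e t) (nodes (Suc n) (renorm M) t)"
  proof (rule inj_onI)
    fix e e' assume e: "e \<in> nodes (Suc n) (renorm M) t" and e': "e' \<in> nodes (Suc n) (renorm M) t"
      and eq: "nxt (renorm M) e t = nxt (renorm M) e' t"
    have "exits M t (first_exit M t (tile_step M t (expand M e)))" if "e \<in> nodes (Suc n) (renorm M) t" for e
      using renorm_path[OF assms that] by metis
    then have "first_exit M t (tile_step M t (expand M e)) = first_exit M t (tile_step M t (expand M e'))"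
      using e e' eq expand_collapse unfolding nxt_renorm by metis
    then have "expand M e = expand M e'"
      using inj_on_first_return[where E = "exits M t", OF finite_tile_nodes[OF assms]
          inj_on_tile_step[OF assms] tile_step_closed[OF assms]] exits_expand[OF e] exits_expand[OF e']
      unfolding first_exit_def by (auto dest: inj_onD)
    then show "e = e'"
      using exits_expand(3)[OF e] exits_expand(3)[OF e'] by metis
  qed
next
  fix q assume "idx (renorm M) q = I0"
  then show "(q \<in> states (renorm M) 0) = (q \<in> states (renorm M) 1)"
    by (simp add: states_renorm tile_def)
qed

lemma proper_renorm:
  "proper (renorm M)"
proof -
  have "next_label y \<noteq> Some La" for y
  proof (cases y)
    case (Some x)
    then show ?thesis by (cases x) (auto simp: next_label_def)
  qed (simp add: next_label_def)
  then show ?thesis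
    unfolding proper_def by (auto simp: states_renorm tile_def)
qed

text \<open>An \<open>I0\<close>-state occurs for both tile shapes. Fusing it with its successor
  therefore needs a transition seen in the three-vertex tile to hold in the five-vertex tile as
  well.\<close>

definition coherent :: "machine \<Rightarrow> bool" where
  "coherent M \<longleftrightarrow> (\<forall>p\<in>states M 1. \<forall>q\<in>states M 1.
     idx M p = I0 \<longrightarrow> idx M q = I0 \<longrightarrow> nxt M (St p) 1 = St q \<longrightarrow> nxt M (St p) 0 = St q)"

text \<open>In the three-vertex tile, a walk from the end \<open>010\<close> back to it never meets an \<open>I2\<close>-letter at
  the other end \<open>100\<close>, so it takes the same course in the five-vertex tile.\<close>

lemma coherent_renorm:
  assumes "valid n M"
  shows "coherent (renorm M)"
  unfolding coherent_def
proof (intro ballI impI)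
  fix p q
  assume p: "p \<in> states (renorm M) 1" "idx (renorm M) p = I0"
    and q: "q \<in> states (renorm M) 1" "idx (renorm M) q = I0"
    and pq: "nxt (renorm M) (St p) 1 = St q"
  let ?f = "\<lambda>t. tile_step M t"
  let ?z = "(St p, P010)"
  have e: "St p \<in> nodes (Suc n) (renorm M) 1" using p by simp
  have z: "expand M (St p) = ?z" using p by simp
  obtain k where k: "k > 0" "first_exit M 1 (?f 1 ?z) = (?f 1 ^^ k) ?z" "exits M 1 ((?f 1 ^^ k) ?z)"
    "\<And>j. 0 < j \<Longrightarrow> j < k \<Longrightarrow> \<not> exits M 1 ((?f 1 ^^ j) ?z)"
    using renorm_path[OF assms e] unfolding z by metis
  have last: "(?f 1 ^^ k) ?z = (St q, P010)"
    using expand_collapse[OF k(3)] pq k(2) z q by (simp add: nxt_renorm)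
  have same: "(?f 0 ^^ j) ?z = (?f 1 ^^ j) ?z" if "j \<le> k" for j
    using that
  proof (induction j)
    case (Suc j)
    have "?f 0 ((?f 1 ^^ j) ?z) = ?f 1 ((?f 1 ^^ j) ?z)"
    proof (cases "j = 0")
      case True
      then show ?thesis using p by (simp add: mv_def)
    next
      case False
      then have ne: "\<not> exits M 1 ((?f 1 ^^ j) ?z)" using k(4)[of j] Suc.prems by simp
      then obtain r x where rx: "(?f 1 ^^ j) ?z = (St r, x)"
        by (cases "(M, 1 :: bit, (?f 1 ^^ j) ?z)" rule: exits.cases) auto
      have "x \<in> tile 1"
        using path_in_tile_nodes[OF assms e, of j] rx z by (simp add: tile_nodes_def)
      \<comment> \<open>On these positions \<open>move\<close> depends on the shape only for
        \<open>I2\<close> at \<open>P100\<close> or \<open>P101\<close>; the first is an exit for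
        \<open>t = 1\<close>, the second is outside \<open>tile 1\<close>.\<close>
      then have "mv 0 (idx M r) (lab M r) x = mv 1 (idx M r) (lab M r) x"
        using ne unfolding rx by (cases "idx M r") (auto simp: mv_def tile_def)
      then show ?thesis unfolding rx by simp
    qed
    with Suc show ?case by simp
  qed simp
  have "first_exit M 0 ((?f 0 ^^ 1) ?z) = (?f 0 ^^ k) ?z"
    unfolding first_exit_def
  proof (rule while_funpow)
    show "1 \<le> k" using k(1) by simp
    show "exits M 0 ((?f 0 ^^ k) ?z)" using same[of k] last q by simp
    fix j assume j: "1 \<le> j" "j < k"
    then have ne: "\<not> exits M 1 ((?f 1 ^^ j) ?z)" using k(4)[of j] by simp
    have "\<not> exits M 0 x" if "\<not> exits M 1 x" for x
      using that by (cases "(M, 1 :: bit, x)" rule: exits.cases; cases "idx M (case fst x of St r \<Rightarrow> r)") auto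
    with ne same[of j] j show "\<not> exits M 0 ((?f 0 ^^ j) ?z)" by simp
  qed
  then show "nxt (renorm M) (St p) 0 = St q"
    using same[of k] last z by (simp add: nxt_renorm)
qed

definition alphas :: "machine \<Rightarrow> nat set" where
  "alphas M = {q \<in> states M 1. idx M q = I0}"

text \<open>The first states of chains of consecutive \<open>I0\<close>-states over the three-vertex
  tile. Once everything is fused, every \<open>I0\<close>-state is a head.\<close>

definition heads :: "machine \<Rightarrow> nat set" where
  "heads M = {q \<in> alphas M. \<forall>p\<in>alphas M. nxt M (St p) 1 \<noteq> St q}"

lemma finite_alphas: "valid n M \<Longrightarrow> finite (alphas M)"
  by (simp add: valid_def alphas_def)

text \<open>In the three-vertex tile, a walk from the end \<open>100\<close> to the end \<open>010\<close> crosses the edge from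
  \<open>100\<close> to \<open>000\<close>, and the flipping state that does so determines where the walk exits.\<close>

lemma card_heads_renorm:
  assumes "valid n M"
  shows "card (heads (renorm M)) \<le> card {q \<in> alphas M. flips (lab M q)} + card (words (Suc n) 1)"
proof -
  let ?f = "tile_step M 1"
  let ?F = "{q \<in> alphas M. flips (lab M q)}"
  let ?d = "\<lambda>q. collapse (first_exit M 1 (?f (St q, P100)))"
  let ?e = "\<lambda>u. nxt (renorm M) (Wd u) 1"
  have "St ` heads (renorm M) \<subseteq> ?d ` ?F \<union> ?e ` words (Suc n) 1"
  proof (rule image_subsetI)
    fix q assume "q \<in> heads (renorm M)"
    then have q: "q \<in> states (renorm M) 1" "idx M q = I0"
      and head: "\<And>p. p \<in> states (renorm M) 1 \<Longrightarrow> idx M p = I0 \<Longrightarrow> nxt (renorm M) (St p) 1 \<noteq> St q"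
      by (auto simp: heads_def alphas_def)
    from q(1) have "St q \<in> nodes (Suc n) (renorm M) 1" by simp
    then obtain e where e: "e \<in> nodes (Suc n) (renorm M) 1" "nxt (renorm M) e 1 = St q"
      using nxt_surj[OF valid_renorm[OF assms]] by metis
    show "St q \<in> ?d ` ?F \<union> ?e ` words (Suc n) 1"
    proof (cases e)
      case (Wd u)
      with e have "u \<in> words (Suc n) 1" "St q = ?e u" by simp_all
      then show ?thesis by blast
    next
      case (St p)
      have p: "p \<in> states (renorm M) 1" using e(1) St by simp
      \<comment> \<open>There are no \<open>I1\<close>-states on the three-vertex side, and an
        \<open>I0\<close>-predecessor would contradict that \<open>q\<close> is a head.\<close>
      then have "idx M p = I2"
        using head[OF p] e(2) St by (cases "idx M p") (auto simp: states_renorm tile_def)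
      then have z: "expand M e = (St p, P100)" using St by simp
      let ?z = "(St p, P100)"
      obtain k where k: "k > 0" "first_exit M 1 (?f ?z) = (?f ^^ k) ?z" "exits M 1 ((?f ^^ k) ?z)"
        "\<And>j. 0 < j \<Longrightarrow> j < k \<Longrightarrow> \<not> exits M 1 ((?f ^^ j) ?z)"
        using renorm_path[OF assms e(1)] unfolding z by metis
      have last: "(?f ^^ k) ?z = (St q, P010)"
        using expand_collapse[OF k(3)] e(2) k(2) z q by (simp add: nxt_renorm)
      have "\<exists>j<k. snd ((?f ^^ j) ?z) = P100 \<and> snd ((?f ^^ Suc j) ?z) \<noteq> P100"
      proof (rule ccontr)
        assume no: "\<not> ?thesis"
        have "snd ((?f ^^ j) ?z) = P100" if "j \<le> k" for j
          using that
        proof (induction j)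
          case (Suc j)
          then show ?case using no by (metis Suc_le_eq less_imp_le_nat)
        qed simp
        from this[of k] last show False by simp
      qed
      then obtain j where j: "j < k" "snd ((?f ^^ j) ?z) = P100" "snd ((?f ^^ Suc j) ?z) \<noteq> P100"
        by blast
      then obtain r where r: "(?f ^^ j) ?z = (St r, P100)"
        by (cases "(M, 1 :: bit, (?f ^^ j) ?z)" rule: exits.cases) auto
      have "mv 1 (idx M r) (lab M r) P100 \<noteq> P100"
        using j(3) r by (simp add: Let_def)
      then have "idx M r = I0" "flips (lab M r)"
        by (cases "idx M r"; auto simp: mv_def split: if_splits)+
      moreover have "r \<in> states M 1"
        using path_in_tile_nodes[OF assms e(1), of j] z r by (simp add: tile_nodes_def)
      ultimately have "r \<in> ?F" by (simp add: alphas_def)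
      \<comment> \<open>No exit occurs from time \<open>Suc j\<close> until \<open>k\<close>, so the
        walk restarted from the crossing by \<open>r\<close> ends at the same
        \<open>q\<close>.\<close>
      moreover have "first_exit M 1 ((?f ^^ Suc j) ?z) = (?f ^^ k) ?z"
        unfolding first_exit_def
        by (rule while_funpow) (use j k in auto)
      then have "St q = ?d r"
        using r last by simp
      ultimately show ?thesis by blast
    qed
  qed
  then have "card (St ` heads (renorm M)) \<le> card (?d ` ?F \<union> ?e ` words (Suc n) 1)"
    using finite_alphas[OF assms] by (intro card_mono) auto
  also have "\<dots> \<le> card (?d ` ?F) + card (?e ` words (Suc n) 1)"
    by (rule card_Un_le)
  also have "\<dots> \<le> card ?F + card (words (Suc n) 1)"
    using finite_alphas[OF assms] by (intro add_mono card_image_le) auto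
  finally show ?thesis
    by (simp add: card_image inj_on_def)
qed

section \<open>Renormalization preserves the represented map\<close>

lemma first_exit_exit: "exits M t z \<Longrightarrow> first_exit M t z = z"
  unfolding first_exit_def by (subst while_unfold) simp

lemma first_exit_step: "\<not> exits M t z \<Longrightarrow> first_exit M t z = first_exit M t (tile_step M t z)"
  unfolding first_exit_def by (subst while_unfold) simp

lemma word_neq_Nil [simp]: "word p \<noteq> []"
  by (cases p) simp_all

lemma hd_word [simp]: "hd (word p) = first_bit p"
  by (simp add: first_bit_def)

lemma tile_step_special:
  "special t (idx M q) p \<Longrightarrow> tile_step M t (St q, p) = (nxt M (St q) (first_bit p), p)"
  by (simp add: mv_special)

lemma special_act:
  assumes "v \<in> \<X>" "p \<in> tile (shd v)" "special (shd v) i p"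
  shows "special (shd (act i y v)) i p" "p \<in> tile (shd (act i y v))"
  using assms shd_act[OF assms(1), of i y] by (cases i; auto simp: tile_def)+

text \<open>Induction along the run of \<open>M\<close>, tracking the position \<open>p\<close> of
  the tail in its tile. A letter that is not special only advances the walk to the first exit; a
  special one is a letter of the renormalized machine acting on \<open>v\<close>. Halting appends
  the final position to the word, so only the concatenated results are compared.\<close>

lemma runs_renorm:
  assumes "runs M e x w x'"
  shows "e = St q \<Longrightarrow> x = word p @- v \<Longrightarrow> v \<in> \<X> \<Longrightarrow> p \<in> tile (shd v) \<Longrightarrow>
    \<exists>u v'. w @- x' = u @- v' \<and>
      (case collapse (first_exit M (shd v) (e, p)) of
        St r \<Rightarrow> runs (renorm M) (St r) v u v'
      | Wd u' \<Rightarrow> u' = u \<and> v' = v)"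
  using assms
proof (induction arbitrary: q p v)
  case (halt e x w)
  let ?i = "idx M q" and ?y = "lab M q"
  show ?case
  proof (cases "special (shd v) ?i p")
    case True
    define v1 where "v1 = act ?i (next_label ?y) v"
    have eff: "effect M e x = word p @- v1"
      using halt True by (simp add: act_special v1_def)
    \<comment> \<open>An \<open>I0\<close>-letter may change the shape of the tile, but
      \<open>P010\<close> is a vertex and an exit of both shapes.\<close>
    have v1: "special (shd v1) ?i p" "p \<in> tile (shd v1)"
      using special_act[OF halt(4,5) True] by (simp_all add: v1_def)
    have "tile_step M (shd v1) (expand M (St q)) = (Wd w, p)"
      using special_home[OF True] halt(1,2) eff tile_step_special[OF v1(1)] by simp
    then have "runs (renorm M) (St q) v (w @ word p) (effect (renorm M) (St q) v)"
      by (intro runs.halt) (simp add: nxt_renorm first_exit_exit v1_def[symmetric])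
    then show ?thesis
      using halt(2) True eff
      by (intro exI[of _ "w @ word p"] exI[of _ v1]) (simp add: first_exit_exit v1_def)
  next
    case False
    define p' where "p' = mv (shd v) ?i ?y p"
    have eff: "effect M e x = word p' @- v"
      using halt False by (simp add: act_move p'_def)
    have "first_exit M (shd v) (St q, p) = (Wd w, p')"
      using False halt(1,2) eff
      by (simp add: first_exit_step first_exit_exit Let_def p'_def[symmetric])
    then show ?thesis
      using halt(2) eff by (intro exI[of _ "w @ word p'"] exI[of _ v]) simp
  qed
next
  case (continue e x r w x')
  let ?i = "idx M q" and ?y = "lab M q"
  show ?case
  proof (cases "special (shd v) ?i p")
    case True
    define v1 where "v1 = act ?i (next_label ?y) v"
    have eff: "effect M e x = word p @- v1"
      using continue True by (simp add: act_special v1_def)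
    have v1: "special (shd v1) ?i p" "p \<in> tile (shd v1)" "v1 \<in> \<X>"
      using special_act[OF continue(6,7) True] act_closed[OF continue(6)] by (simp_all add: v1_def)
    obtain u v' where u: "w @- x' = u @- v'"
      "case collapse (first_exit M (shd v1) (St r, p)) of
        St r \<Rightarrow> runs (renorm M) (St r) v1 u v'
      | Wd u' \<Rightarrow> u' = u \<and> v' = v1"
      using continue.IH[OF refl eff v1(3,2)] by blast
    have "tile_step M (shd v1) (expand M (St q)) = (St r, p)"
      using special_home[OF True] continue(1,4) eff tile_step_special[OF v1(1)] by simp
    then have nx: "nxt (renorm M) (St q) (shd v1) = collapse (first_exit M (shd v1) (St r, p))"
      by (simp add: nxt_renorm)
    have v1': "effect (renorm M) (St q) v = v1" by (simp add: v1_def)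
    have "runs (renorm M) (St q) v u v'"
    proof (cases "collapse (first_exit M (shd v1) (St r, p))")
      case (St r')
      show ?thesis
      proof (rule runs.continue)
        show "nxt (renorm M) (St q) (shd (effect (renorm M) (St q) v)) = St r'"
          using nx v1' St by simp
        show "runs (renorm M) (St r') (effect (renorm M) (St q) v) u v'"
          using u(2) v1' St by simp
      qed
    next
      case (Wd u')
      then have "u' = u" "v' = effect (renorm M) (St q) v" using u(2) v1' by auto
      then show ?thesis
        using nx v1' Wd runs.halt[of "renorm M" "St q" v u] by simp
    qed
    then show ?thesis
      using continue(4) True u(1) by (intro exI[of _ u] exI[of _ v']) (simp add: first_exit_exit)
  next
    case False
    define p' where "p' = mv (shd v) ?i ?y p"
    have eff: "effect M e x = word p' @- v"
      using continue False by (simp add: act_move p'_def)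
    have "first_exit M (shd v) (St q, p) = first_exit M (shd v) (St r, p')"
      using False continue(1,4) eff
      by (simp add: first_exit_step[of M "shd v" "(St q, p)"] Let_def p'_def[symmetric])
    then show ?thesis
      using continue.IH[OF refl eff continue(6)] continue(4,7) mv_in_tile p'_def by simp
  qed
qed

lemma represents_renorm:
  assumes "represents n M g"
  shows "represents (Suc n) (renorm M) g"
  unfolding represents_def
proof (intro ballI)
  fix v u assume v: "v \<in> \<X>" and "u \<in> words (Suc n) (shd v)"
  then obtain p w where p: "p \<in> tile (shd v)" and w: "w \<in> words n (first_bit p)" and u: "u = w @ word p"
    by auto
  have "w \<in> words n (shd (word p @- v))" using w by simp
  with tile_in_X[OF v p] obtain w' x'
    where r: "runs M (Wd w) (word p @- v) w' x'" "g (w @- word p @- v) = w' @- x'"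
    using assms unfolding represents_def by blast
  have nx: "nxt (renorm M) (Wd u) (shd v) = collapse (first_exit M (shd v) (nxt M (Wd w) (first_bit p), p))"
    by (simp add: nxt_renorm u)
  have "\<exists>u' v'. w' @- x' = u' @- v' \<and> runs (renorm M) (Wd u) v u' v'"
    using r(1)
  proof cases
    case halt
    then have "nxt (renorm M) (Wd u) (shd v) = Wd (w' @ word p)"
      using nx by (simp add: first_exit_exit)
    then have "runs (renorm M) (Wd u) v (w' @ word p) (effect (renorm M) (Wd u) v)"
      by (intro runs.halt) simp
    then show ?thesis
      using halt by (intro exI[of _ "w' @ word p"] exI[of _ v]) simp
  next
    case (continue q)
    obtain u' v' where u': "w' @- x' = u' @- v'"
      "case collapse (first_exit M (shd v) (St q, p)) of
        St r \<Rightarrow> runs (renorm M) (St r) v u' v'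
      | Wd u'' \<Rightarrow> u'' = u' \<and> v' = v"
      using runs_renorm[OF continue(2) refl _ v p] by auto
    have nx: "nxt (renorm M) (Wd u) (shd v) = collapse (first_exit M (shd v) (St q, p))"
      using nx continue(1) by simp
    have "runs (renorm M) (Wd u) v u' v'"
    proof (cases "collapse (first_exit M (shd v) (St q, p))")
      case (St r')
      show ?thesis
      proof (rule runs.continue)
        show "nxt (renorm M) (Wd u) (shd (effect (renorm M) (Wd u) v)) = St r'"
          using nx St by simp
        show "runs (renorm M) (St r') (effect (renorm M) (Wd u) v) u' v'"
          using u'(2) St by simp
      qed
    next
      case (Wd u'')
      then show ?thesis
        using u'(2) nx runs.halt[of "renorm M" "Wd u" v u'] by simp
    qed
    with u' show ?thesis by blast
  qed
  then show "\<exists>w' v'. runs (renorm M) (Wd u) v w' v' \<and> g (u @- v) = w' @- v'"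
    using r(2) u by auto
qed

section \<open>Compression\<close>

text \<open>The potential \<open>\<Sum> weight\<close> over the \<open>I0\<close>-states shrinks by the factor \<open>6/7\<close> under
  renormalization followed by compression. The weights solve the linear program
  \<open>weight y \<le> price y + 19\<close> and \<open>price (next_label y) + (if flips y then 19 else 0) \<le> 6/7 * weight y\<close>
  with \<open>price\<close> subadditive on the Klein four-group.\<close>

fun weight :: "label option \<Rightarrow> nat" where
  "weight (Some Lb) = 49"
| "weight (Some Lc) = 42"
| "weight (Some Ld) = 36"
| "weight _ = 0"

fun price :: "label option \<Rightarrow> nat" where
  "price (Some Lb) = 30"
| "price (Some Lc) = 23"
| "price (Some Ld) = 17"
| "price _ = 0"

lemma weight_le: "weight y \<le> price y + 19"
  by (cases y rule: weight.cases) simp_all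

lemma price_next_label:
  "y \<noteq> Some La \<Longrightarrow> 7 * (price (next_label y) + (if flips y then 19 else 0)) \<le> 6 * weight y"
  by (cases y rule: weight.cases) (simp_all add: next_label_def flips_def)

lemma weight_flips: "y \<noteq> Some La \<Longrightarrow> flips y \<Longrightarrow> 42 \<le> weight y"
  by (cases y rule: weight.cases) (simp_all add: flips_def)

lemma label_mult_neq_La: "x \<noteq> Some La \<Longrightarrow> y \<noteq> Some La \<Longrightarrow> label_mult x y \<noteq> Some La"
  by (cases "(x, y)" rule: label_mult.cases) auto

lemma price_label_mult:
  assumes "x \<noteq> Some La" "y \<noteq> Some La"
  shows "price (label_mult x y) \<le> price x + price y"
  by (cases x rule: weight.cases; cases y rule: weight.cases) (use assms in auto)

section \<open>Fusing consecutive letters of equal index\<close>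

fun side :: "index \<Rightarrow> bit" where
  "side I0 = 1"
| "side I1 = 0"
| "side I2 = 1"

text \<open>Two letters of equal index act on the tail in succession. In a proper machine,
  \<open>I1\<close>- and \<open>I2\<close>-states exist only for the shape given by
  \<open>side\<close>; for \<open>I0\<close>, coherence extends the condition from shape 1 to shape
  0.\<close>

definition bounce :: "machine \<Rightarrow> nat \<Rightarrow> nat \<Rightarrow> bool" where
  "bounce M p q \<longleftrightarrow> idx M p = idx M q \<and> p \<in> states M (side (idx M q)) \<and> q \<in> states M (side (idx M q)) \<and>
     nxt M (St p) (side (idx M q)) = St q"

text \<open>\<open>p\<close> receives the product of both letters and the successor of
  \<open>q\<close>. If \<open>p = q\<close>, the state is a closed loop, which is deleted.\<close>

definition fuse :: "machine \<Rightarrow> nat \<Rightarrow> nat \<Rightarrow> machine" where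
  "fuse M p q = \<lparr>states = (\<lambda>t. states M t - {q}), idx = idx M,
     lab = (lab M)(p := label_mult (lab M p) (lab M q)), nxt = (nxt M)(St p := nxt M (St q))\<rparr>"

context
  fixes n :: nat and M :: machine and p q :: nat
  assumes valid: "valid n M" and proper: "proper M" and coherent: "coherent M" and bounce: "bounce M p q"
begin

lemma states_fuse [simp]: "states (fuse M p q) t = states M t - {q}"
  and idx_fuse [simp]: "idx (fuse M p q) = idx M"
  and lab_fuse: "lab (fuse M p q) = (lab M)(p := label_mult (lab M p) (lab M q))"
  and nxt_fuse: "nxt (fuse M p q) = (nxt M)(St p := nxt M (St q))"
  by (simp_all add: fuse_def)

lemma bounce_states: "p \<in> states M t \<longleftrightarrow> q \<in> states M t"
proof -
  have pq: "idx M p = idx M q" "p \<in> states M (side (idx M q))" "q \<in> states M (side (idx M q))"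
    using bounce by (auto simp: bounce_def)
  show ?thesis
  proof (cases "idx M q")
    case I0
    then show ?thesis using pq states_I0[OF valid] by metis
  next
    case I1
    then show ?thesis using pq proper unfolding proper_def by (cases t) auto
  next
    case I2
    then show ?thesis using pq proper unfolding proper_def by (cases t) auto
  qed
qed

lemma bounce_nxt:
  assumes "p \<in> states M t"
  shows "nxt M (St p) t = St q"
proof -
  have pq: "idx M p = idx M q" "p \<in> states M (side (idx M q))" "q \<in> states M (side (idx M q))"
    "nxt M (St p) (side (idx M q)) = St q"
    using bounce by (auto simp: bounce_def)
  show ?thesis
  proof (cases "idx M q")
    case I0
    then have "nxt M (St p) 0 = St q" "nxt M (St p) 1 = St q"
      using pq coherent unfolding coherent_def by auto
    then show ?thesis by (cases t) simp_all
  next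
    case I1
    then show ?thesis using pq assms proper unfolding proper_def by (cases t) auto
  next
    case I2
    then show ?thesis using pq assms proper unfolding proper_def by (cases t) auto
  qed
qed

lemma nodes_fuse: "nodes n (fuse M p q) t = nodes n M t - {St q}"
  by (auto simp: nodes_def)

text \<open>By injectivity \<open>p\<close> is the only predecessor of \<open>q\<close>, so deleting
  \<open>q\<close> leaves no other transition dangling.\<close>

lemma nxt_eq_bounce:
  assumes "e \<in> nodes n M t" "nxt M e t = St q"
  shows "e = St p"
proof -
  have "q \<in> states M t"
    using nxt_closed[OF valid assms(1)] assms(2) by simp
  then have p: "p \<in> states M t" using bounce_states by simp
  show ?thesis
    by (rule nxt_inj[OF valid, of e t]) (use assms bounce_nxt[OF p] p in auto)
qed

lemma valid_fuse: "valid n (fuse M p q)"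
  unfolding valid_def
proof (intro conjI allI ballI impI)
  fix t
  \<comment> \<open>A fused step at \<open>e\<close> is an old step at \<open>s e\<close>. On the
    surviving nodes \<open>s\<close> is injective and avoids \<open>St p\<close>, the only node
    leading to \<open>q\<close>.\<close>
  define s where "s e = (if e = St p then St q else e)" for e
  have nxt: "nxt (fuse M p q) e t = nxt M (s e) t" for e
    by (simp add: nxt_fuse s_def)
  have s: "s e \<in> nodes n M t" if "e \<in> nodes n (fuse M p q) t" for e
    using that bounce_states by (auto simp: s_def nodes_fuse)
  have s_neq: "s e \<noteq> St p" if "e \<in> nodes n (fuse M p q) t" for e
    using that by (auto simp: s_def nodes_fuse)
  show "finite (states (fuse M p q) t)"
    using valid by (simp add: valid_def)
  show "inj_on (\<lambda>e. nxt (fuse M p q) e t) (nodes n (fuse M p q) t)"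
  proof (rule inj_onI)
    fix e e' assume e: "e \<in> nodes n (fuse M p q) t" "e' \<in> nodes n (fuse M p q) t"
      and "nxt (fuse M p q) e t = nxt (fuse M p q) e' t"
    then have "s e = s e'"
      using nxt_inj[OF valid] s unfolding nxt by blast
    then show "e = e'"
      using e by (auto simp: s_def nodes_fuse split: if_splits)
  qed
  fix e assume e: "e \<in> nodes n (fuse M p q) t"
  then show "nxt (fuse M p q) e t \<in> nodes n (fuse M p q) t"
    using nxt_closed[OF valid s[OF e]] nxt_eq_bounce[OF s[OF e]] s_neq[OF e]
    unfolding nxt nodes_fuse by blast
next
  fix r assume "idx (fuse M p q) r = I0"
  then show "(r \<in> states (fuse M p q) 0) = (r \<in> states (fuse M p q) 1)"
    using states_I0[OF valid, of r 0 1] states_I0[OF valid, of r 1 0] by auto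
qed

lemma proper_fuse: "proper (fuse M p q)"
proof -
  have "lab (fuse M p q) r \<noteq> Some La" if "r \<in> states M t" for r t
  proof (cases "r = p")
    case True
    then have "lab M p \<noteq> Some La" "lab M q \<noteq> Some La"
      using proper that bounce_states[of t] unfolding proper_def by auto
    then show ?thesis using True by (simp add: lab_fuse label_mult_neq_La)
  next
    case False
    then show ?thesis using proper that unfolding proper_def by (auto simp: lab_fuse)
  qed
  then show ?thesis
    using proper unfolding proper_def by auto
qed

lemma bounce_idx: "idx M p = idx M q"
  using bounce by (simp add: bounce_def)

lemma coherent_fuse: "coherent (fuse M p q)"
  unfolding coherent_def
proof (intro ballI impI)
  fix a b
  assume a: "a \<in> states (fuse M p q) 1" "idx (fuse M p q) a = I0"
    and b: "b \<in> states (fuse M p q) 1" "idx (fuse M p q) b = I0"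
    and ab: "nxt (fuse M p q) (St a) 1 = St b"
  define a' where "a' = (if a = p then q else a)"
  have nxt: "nxt (fuse M p q) (St a) t = nxt M (St a') t" for t
    by (simp add: nxt_fuse a'_def)
  have "a' \<in> states M 1" "idx M a' = I0"
    using a bounce_states bounce_idx by (auto simp: a'_def)
  then show "nxt (fuse M p q) (St a) 0 = St b"
    using coherent b ab unfolding coherent_def nxt by auto
qed

text \<open>A state preceded by \<open>q\<close> is preceded by \<open>p\<close> after the fusion,
  so no surviving state loses its \<open>I0\<close>-predecessor.\<close>

lemma heads_fuse: "heads (fuse M p q) \<subseteq> heads M"
proof
  fix r assume r: "r \<in> heads (fuse M p q)"
  then have r': "r \<in> alphas M" "r \<noteq> q" by (auto simp: heads_def alphas_def)
  have "nxt M (St a) 1 \<noteq> St r" if a: "a \<in> alphas M" for a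
  proof
    assume ar: "nxt M (St a) 1 = St r"
    have "a \<noteq> p"
      using ar bounce_nxt[of 1] a r' by (auto simp: alphas_def)
    show False
    proof (cases "a = q")
      case True
      then have "p \<in> alphas (fuse M p q)"
        using a bounce_states bounce_idx \<open>a \<noteq> p\<close> by (auto simp: alphas_def)
      moreover have "nxt (fuse M p q) (St p) 1 = St r"
        using ar True by (simp add: nxt_fuse)
      ultimately show False using r by (auto simp: heads_def)
    next
      case False
      then have "a \<in> alphas (fuse M p q)" using a by (auto simp: alphas_def)
      moreover have "nxt (fuse M p q) (St a) 1 = St r"
        using ar \<open>a \<noteq> p\<close> by (simp add: nxt_fuse)
      ultimately show False using r by (auto simp: heads_def)
    qed
  qed
  with r' show "r \<in> heads M" by (auto simp: heads_def)
qed

lemma price_fuse: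
  "(\<Sum>r\<in>alphas (fuse M p q). price (lab (fuse M p q) r)) \<le> (\<Sum>r\<in>alphas M. price (lab M r))"
proof -
  let ?A = "alphas M"
  have A: "alphas (fuse M p q) = ?A - {q}" by (auto simp: alphas_def)
  have fin: "finite ?A" by (rule finite_alphas[OF valid])
  have pq: "p \<in> ?A \<longleftrightarrow> q \<in> ?A"
    using bounce_states bounce_idx by (auto simp: alphas_def)
  have le: "price (lab (fuse M p q) r) \<le> price (lab M r) + (if r = p then price (lab M q) else 0)"
    if "r \<in> ?A - {q}" for r
  proof (cases "r = p")
    case True
    then have "lab M p \<noteq> Some La" "lab M q \<noteq> Some La"
      using that pq proper unfolding alphas_def proper_def by auto
    then show ?thesis using True by (simp add: lab_fuse price_label_mult)
  qed (simp add: lab_fuse)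
  have "(\<Sum>r\<in>?A - {q}. price (lab (fuse M p q) r))
    \<le> (\<Sum>r\<in>?A - {q}. price (lab M r)) + (\<Sum>r\<in>?A - {q}. if r = p then price (lab M q) else 0)"
    unfolding sum.distrib[symmetric] by (rule sum_mono[OF le])
  also have "(\<Sum>r\<in>?A - {q}. if r = p then price (lab M q) else 0) \<le> (if q \<in> ?A then price (lab M q) else 0)"
    using fin pq by (simp add: sum.delta)
  also have "(\<Sum>r\<in>?A - {q}. price (lab M r)) + (if q \<in> ?A then price (lab M q) else 0) = (\<Sum>r\<in>?A. price (lab M r))"
    using fin by (auto simp: sum.remove add.commute)
  finally show ?thesis unfolding A by simp
qed

text \<open>The fused machine has no node \<open>q\<close>. The second conjunct therefore compares a
  run from \<open>q\<close> with the fused run that starts one letter earlier, at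
  \<open>p\<close>.\<close>

lemma runs_fuse:
  assumes "runs M e v w v'" "v \<in> \<X>" "e \<in> nodes n M (shd v)"
  shows "(e \<noteq> St q \<longrightarrow> runs (fuse M p q) e v w v') \<and>
    (e = St q \<longrightarrow> (\<forall>u\<in>\<X>. p \<noteq> q \<longrightarrow> effect M (St p) u = v \<longrightarrow> runs (fuse M p q) (St p) u w v'))"
  using assms
proof (induction)
  case (halt e v w)
  show ?case
  proof (intro conjI impI ballI)
    assume "e \<noteq> St q"
    have e': "e \<in> nodes n M (shd (effect M e v))"
      using nodes_effect[OF valid halt(3,2)] .
    have "e \<noteq> St p"
      using halt(1) bounce_nxt e' by auto
    then have "effect (fuse M p q) e v = effect M e v"
      by (cases e) (auto simp: lab_fuse)
    then show "runs (fuse M p q) e v w (effect M e v)"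
      using runs.halt[of "fuse M p q" e v w] halt(1) \<open>e \<noteq> St p\<close> by (simp add: nxt_fuse)
  next
    fix u assume e: "e = St q" and u: "u \<in> \<X>" "p \<noteq> q" "effect M (St p) u = v"
    have q: "q \<in> states M (shd v)" "p \<in> states M (shd v)"
      using halt(3) e bounce_states by auto
    then have "effect M e v = effect (fuse M p q) (St p) u"
      using u proper e bounce_idx unfolding proper_def
      by (auto simp: lab_fuse act_act)
    then show "runs (fuse M p q) (St p) u w (effect M e v)"
      using runs.halt[of "fuse M p q" "St p" u w] halt(1) e by (simp add: nxt_fuse)
  qed
next
  case (continue e v r w v')
  have e': "e \<in> nodes n M (shd (effect M e v))"
    using nodes_effect[OF valid continue(5,4)] .
  have v1: "effect M e v \<in> \<X>" using effect_closed continue(4) .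
  have r: "St r \<in> nodes n M (shd (effect M e v))"
    using nxt_closed[OF valid e'] continue(1) by simp
  note IH = continue.IH[OF v1 r]
  show ?case
  proof (intro conjI impI ballI)
    assume "e \<noteq> St q"
    show "runs (fuse M p q) e v w v'"
    proof (cases "e = St p")
      case True
      then have "p \<noteq> q" using \<open>e \<noteq> St q\<close> by auto
      moreover have "r = q" using bounce_nxt e' continue(1) True by simp
      ultimately show ?thesis
        using IH continue(4) True by auto
    next
      case False
      then have eff: "effect (fuse M p q) e v = effect M e v"
        by (cases e) (auto simp: lab_fuse)
      have "r \<noteq> q" using nxt_eq_bounce[OF e'] continue(1) False by auto
      then have "runs (fuse M p q) (St r) (effect M e v) w v'" using IH by simp
      then show ?thesis
        using runs.continue[of "fuse M p q" e v r w v'] continue(1) False eff by (simp add: nxt_fuse)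
    qed
  next
    fix u assume e: "e = St q" and u: "u \<in> \<X>" "p \<noteq> q" "effect M (St p) u = v"
    have q: "q \<in> states M (shd v)" "p \<in> states M (shd v)"
      using continue(5) e bounce_states by auto
    then have eff: "effect (fuse M p q) (St p) u = effect M e v"
      using u proper e bounce_idx unfolding proper_def
      by (auto simp: lab_fuse act_act)
    have "r \<noteq> q" using nxt_eq_bounce[OF e'] continue(1) e u by auto
    then have "runs (fuse M p q) (St r) (effect M e v) w v'" using IH by simp
    then show "runs (fuse M p q) (St p) u w v'"
      using runs.continue[of "fuse M p q" "St p" u r w v'] continue(1) e eff by (simp add: nxt_fuse)
  qed
qed

lemma represents_fuse: "represents n M g \<Longrightarrow> represents n (fuse M p q) g"
  unfolding represents_def using runs_fuse by (metis Wd_in_nodes node.distinct(1))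

end

text \<open>Each fusion deletes a state, so the process stops at a machine without bounces.\<close>

lemma fuse_all:
  assumes "valid n M" "proper M" "coherent M"
  shows "\<exists>M'. valid n M' \<and> proper M' \<and> (\<forall>t. states M' t \<subseteq> states M t) \<and>
    (\<forall>g. represents n M g \<longrightarrow> represents n M' g) \<and>
    (\<Sum>r\<in>alphas M'. price (lab M' r)) \<le> (\<Sum>r\<in>alphas M. price (lab M r)) \<and>
    heads M' \<subseteq> heads M \<and> (\<forall>p q. \<not> bounce M' p q)"
  using assms
proof (induction "card (states M 0 \<union> states M 1)" arbitrary: M rule: less_induct)
  case less
  show ?case
  proof (cases "\<exists>p q. bounce M p q")
    case False
    then show ?thesis using less.prems by (intro exI[of _ M]) simp
  next
    case True
    then obtain p q where b: "bounce M p q" by blast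
    let ?M = "fuse M p q"
    have fin: "finite (states M 0 \<union> states M 1)"
      using less.prems(1) by (simp add: valid_def)
    have "q \<in> states M 0 \<union> states M 1"
      using b unfolding bounce_def by (cases "side (idx M q)") auto
    then have "states ?M 0 \<union> states ?M 1 \<subset> states M 0 \<union> states M 1"
      by (auto simp: fuse_def)
    then have "card (states ?M 0 \<union> states ?M 1) < card (states M 0 \<union> states M 1)"
      by (rule psubset_card_mono[OF fin])
    from less.hyps[OF this valid_fuse[OF less.prems b] proper_fuse[OF less.prems b] coherent_fuse[OF less.prems b]]
    obtain M' where M': "valid n M'" "proper M'" "\<forall>t. states M' t \<subseteq> states ?M t"
      "\<forall>g. represents n ?M g \<longrightarrow> represents n M' g"
      "(\<Sum>r\<in>alphas M'. price (lab M' r)) \<le> (\<Sum>r\<in>alphas ?M. price (lab ?M r))"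
      "heads M' \<subseteq> heads ?M" "\<forall>p q. \<not> bounce M' p q"
      by (elim exE conjE)
    have "states M' t \<subseteq> states M t" for t
      using M'(3) by (auto simp: fuse_def)
    moreover have "\<And>g. represents n M g \<Longrightarrow> represents n M' g"
      using M'(4) represents_fuse[OF less.prems b] by blast
    moreover have "(\<Sum>r\<in>alphas M'. price (lab M' r)) \<le> (\<Sum>r\<in>alphas M. price (lab M r))"
      using M'(5) price_fuse[OF less.prems b] by linarith
    moreover have "heads M' \<subseteq> heads M"
      using M'(6) heads_fuse[OF less.prems b] by blast
    ultimately show ?thesis
      using M'(1,2,7) by blast
  qed
qed

text \<open>Without bounces, the predecessor of an \<open>I1\<close>- or \<open>I2\<close>-state is
  an \<open>I0\<close>-state or an entry word. Each of these two kinds thus numbers at most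
  \<open>card (alphas M) + 5 ^ n\<close>.\<close>

lemma card_states_no_bounce:
  assumes "valid n M" "proper M" "\<And>p q. \<not> bounce M p q"
  shows "alphas M = heads M" "card (states M 0 \<union> states M 1) \<le> 3 * card (alphas M) + 2 * 5 ^ n"
proof -
  have "nxt M (St p) 1 \<noteq> St q" if "p \<in> alphas M" "q \<in> alphas M" for p q
    using assms(3)[of p q] that by (auto simp: alphas_def bounce_def)
  then show "alphas M = heads M"
    unfolding heads_def by blast
  have *: "card {q \<in> states M t. idx M q = i} \<le> card (alphas M) + card (words n t)"
    if i: "i \<noteq> I0" and t: "t = side i" and other: "\<And>q. q \<in> states M t \<Longrightarrow> idx M q \<noteq> I0 \<Longrightarrow> idx M q = i" for i t
  proof -
    let ?e = "\<lambda>e. nxt M e t"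
    have "St ` {q \<in> states M t. idx M q = i} \<subseteq> ?e ` (St ` alphas M \<union> Wd ` words n t)"
    proof (rule image_subsetI)
      fix q assume q: "q \<in> {q \<in> states M t. idx M q = i}"
      then have "St q \<in> nodes n M t" by simp
      then obtain e where e: "e \<in> nodes n M t" "nxt M e t = St q"
        using nxt_surj[OF assms(1)] by metis
      have "e \<in> St ` alphas M \<union> Wd ` words n t"
      proof (cases e)
        case (St p)
        then have p: "p \<in> states M t" using e by simp
        then have "idx M p \<noteq> i"
          using assms(3)[of p q] e(2) q t St by (auto simp: bounce_def)
        then have "idx M p = I0" using other p by blast
        then have "p \<in> alphas M" using states_I0[OF assms(1) _ p] by (simp add: alphas_def)
        then show ?thesis using St by blast
      qed (use e in auto)
      with e(2) show "St q \<in> ?e ` (St ` alphas M \<union> Wd ` words n t)" by (metis imageI)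
    qed
    then have "card (St ` {q \<in> states M t. idx M q = i}) \<le> card (?e ` (St ` alphas M \<union> Wd ` words n t))"
      using finite_alphas[OF assms(1)] by (intro card_mono) auto
    also have "\<dots> \<le> card (St ` alphas M \<union> Wd ` words n t)"
      using finite_alphas[OF assms(1)] by (intro card_image_le) auto
    also have "\<dots> \<le> card (St ` alphas M) + card (Wd ` words n t)"
      by (rule card_Un_le)
    also have "\<dots> \<le> card (alphas M) + card (words n t)"
      using finite_alphas[OF assms(1)] by (intro add_mono card_image_le) auto
    finally show ?thesis by (simp add: card_image inj_on_def)
  qed
  let ?B = "{q \<in> states M 0. idx M q = I1}" and ?C = "{q \<in> states M 1. idx M q = I2}"
  have B: "card ?B \<le> card (alphas M) + 5 ^ n"
    using *[of I1 0] card_words_le[of n 0] assms(2) index.exhaust unfolding proper_def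
    by (metis (full_types) add_left_mono index.distinct(1) order_trans side.simps(2))
  have C: "card ?C \<le> card (alphas M) + 5 ^ n"
    using *[of I2 1] card_words_le[of n 1] assms(2) index.exhaust unfolding proper_def
    by (metis (full_types) add_left_mono index.distinct(3) order_trans side.simps(3))
  have sub: "states M 0 \<union> states M 1 \<subseteq> alphas M \<union> ?B \<union> ?C"
  proof
    fix q assume "q \<in> states M 0 \<union> states M 1"
    then show "q \<in> alphas M \<union> ?B \<union> ?C"
      using assms(2) states_I0[OF assms(1), of q 0 1]
      by (cases "idx M q") (auto simp: alphas_def proper_def)
  qed
  have "card (states M 0 \<union> states M 1) \<le> card (alphas M \<union> ?B \<union> ?C)"
    using sub assms(1) by (intro card_mono) (auto simp: valid_def alphas_def)
  also have "\<dots> \<le> card (alphas M) + card ?B + card ?C"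
    by (meson add_right_mono card_Un_le order_trans)
  also have "\<dots> \<le> 3 * card (alphas M) + 2 * 5 ^ n"
    using B C by simp
  finally show "card (states M 0 \<union> states M 1) \<le> 3 * card (alphas M) + 2 * 5 ^ n" .
qed

section \<open>The recursive inequality for the potential\<close>

definition potential :: "machine \<Rightarrow> nat" where
  "potential M = (\<Sum>q\<in>alphas M. weight (lab M q))"

lemma renormalization_step:
  assumes "valid n M" "proper M"
  obtains M' where "valid (Suc n) M'" "proper M'" "\<And>t. states M' t \<subseteq> states M 0 \<union> states M 1"
    "\<And>g. represents n M g \<Longrightarrow> represents (Suc n) M' g"
    "7 * potential M' \<le> 6 * potential M + 133 * 5 ^ Suc n"
    "card (states M' 0 \<union> states M' 1) \<le> potential M + 5 * 5 ^ Suc n"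
proof -
  let ?R = "renorm M" and ?F = "{q \<in> alphas M. flips (lab M q)}"
  obtain M' where M': "valid (Suc n) M'" "proper M'" "\<forall>t. states M' t \<subseteq> states ?R t"
    "\<forall>g. represents (Suc n) ?R g \<longrightarrow> represents (Suc n) M' g"
    "(\<Sum>r\<in>alphas M'. price (lab M' r)) \<le> (\<Sum>r\<in>alphas ?R. price (lab ?R r))"
    "heads M' \<subseteq> heads ?R" "\<forall>p q. \<not> bounce M' p q"
    using fuse_all[OF valid_renorm[OF assms(1)] proper_renorm coherent_renorm[OF assms(1)]] by (elim exE conjE)
  then have nb: "\<And>p q. \<not> bounce M' p q" by blast
  have fin: "finite (alphas M)" by (rule finite_alphas[OF assms(1)])
  have sub: "states M' t \<subseteq> states M 0 \<union> states M 1" for t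
  proof
    fix q assume "q \<in> states M' t"
    then have "q \<in> states M (first_bit (home (idx M q)))" using M'(3) by (auto simp: states_renorm)
    then show "q \<in> states M 0 \<union> states M 1" by (cases "first_bit (home (idx M q))") auto
  qed
  have "q \<in> states M 0 \<longleftrightarrow> q \<in> states M 1" if "idx M q = I0" for q
    using assms(1) that unfolding valid_def by blast
  \<comment> \<open>\<open>P010\<close> is an exit of both shapes, so renormalization alone keeps
    every \<open>I0\<close>-state; their number drops only through fusion.\<close>
  then have alphas: "alphas ?R = alphas M"
    by (auto simp: alphas_def states_renorm tile_def)
  have "alphas M' = heads M'"
    using card_states_no_bounce(1)[OF M'(1,2) nb] .
  then have "card (alphas M') \<le> card (heads ?R)"
    using M'(6) finite_alphas[OF valid_renorm[OF assms(1)]] by (auto intro!: card_mono simp: heads_def)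
  also have "\<dots> \<le> card ?F + 5 ^ Suc n"
    using card_heads_renorm[OF assms(1)] card_words_le[of "Suc n" 1] by linarith
  finally have card_alphas: "card (alphas M') \<le> card ?F + 5 ^ Suc n" .
  have La: "lab M q \<noteq> Some La" if "q \<in> alphas M" for q
    using that assms(2) unfolding alphas_def proper_def by auto
  \<comment> \<open>Every surviving \<open>I0\<close>-state is charged its price plus 19. The 19s
    are paid by the flipping states and the words, which gives \<open>133 = 7 * 19\<close>.\<close>
  have "potential M' \<le> (\<Sum>r\<in>alphas M'. price (lab M' r) + 19)"
    unfolding potential_def by (rule sum_mono) (rule weight_le)
  also have "\<dots> = (\<Sum>r\<in>alphas M'. price (lab M' r)) + 19 * card (alphas M')"
    by (simp add: sum.distrib)
  also have "\<dots> \<le> (\<Sum>r\<in>alphas M. price (next_label (lab M r))) + 19 * (card ?F + 5 ^ Suc n)"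
    using M'(5) card_alphas unfolding alphas by (intro add_mono mult_le_mono2) auto
  also have "\<dots> = (\<Sum>r\<in>alphas M. price (next_label (lab M r)) + (if flips (lab M r) then 19 else 0)) + 19 * 5 ^ Suc n"
    using fin by (simp add: sum.distrib sum.If_cases Int_def)
  finally have "7 * potential M' \<le> (\<Sum>r\<in>alphas M. 7 * (price (next_label (lab M r)) + (if flips (lab M r) then 19 else 0))) + 133 * 5 ^ Suc n"
    unfolding sum_distrib_left[symmetric] by linarith
  also have "(\<Sum>r\<in>alphas M. 7 * (price (next_label (lab M r)) + (if flips (lab M r) then 19 else 0))) \<le> (\<Sum>r\<in>alphas M. 6 * weight (lab M r))"
    by (rule sum_mono) (rule price_next_label[OF La])
  finally have pot: "7 * potential M' \<le> 6 * potential M + 133 * 5 ^ Suc n"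
    by (simp add: potential_def sum_distrib_left)
  \<comment> \<open>A flipping state weighs at least 42, more than the factor 3 by which
    \<open>card ?F\<close> enters the state count. The words contribute \<open>3 + 2 = 5\<close>
    times \<open>5 ^ Suc n\<close>.\<close>
  have "42 * card ?F = (\<Sum>q\<in>?F. 42)" by simp
  also have "\<dots> \<le> (\<Sum>q\<in>?F. weight (lab M q))"
    by (rule sum_mono) (use weight_flips La in auto)
  also have "\<dots> \<le> potential M"
    unfolding potential_def using fin by (intro sum_mono2) auto
  finally have "card (states M' 0 \<union> states M' 1) \<le> potential M + 5 * 5 ^ Suc n"
    using card_states_no_bounce(2)[OF M'(1,2) nb] card_alphas by linarith
  then show thesis
    using M'(4) represents_renorm by (intro that[OF M'(1,2) sub _ pot]) blast+
qed

section \<open>Counting\<close>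

lemma runs_deterministic:
  "runs M e v w v' \<Longrightarrow> runs M e v u u' \<Longrightarrow> w = u \<and> v' = u'"
proof (induction rule: runs.induct)
  case (halt e v w)
  from halt(2,1) show ?case by cases auto
next
  case (continue e v q w v')
  from continue(4,1) show ?case by cases (use continue.IH in auto)
qed

text \<open>The part of a machine visible on its nodes, as a finite set. Machines with equal codes
  have the same runs, whatever they do elsewhere.\<close>

definition code :: "nat \<Rightarrow> machine \<Rightarrow> (node \<times> bit \<times> (index \<times> label option) \<times> node) set" where
  "code n M = (\<Union>t. (\<lambda>e. (e, t, letter M e, nxt M e t)) ` nodes n M t)"

lemma code_eqD:
  assumes "code n M = code n M'" "e \<in> nodes n M t"
  shows "letter M' e = letter M e" "nxt M' e t = nxt M e t"
proof -
  have "(e, t, letter M e, nxt M e t) \<in> code n M'"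
    using assms unfolding code_def by blast
  then show "letter M' e = letter M e" "nxt M' e t = nxt M e t"
    by (auto simp: code_def)
qed

lemma runs_code:
  assumes "runs M e v w v'" "valid n M" "code n M = code n M'" "v \<in> \<X>" "e \<in> nodes n M (shd v)"
  shows "runs M' e v w v'"
  using assms(1,4,5)
proof (induction rule: runs.induct)
  case (halt e v w)
  have e: "e \<in> nodes n M (shd (effect M e v))"
    using nodes_effect[OF assms(2) halt(3,2)] .
  have "effect M' e v = effect M e v"
    by (simp add: effect_def code_eqD(1)[OF assms(3) e])
  then show ?case
    using runs.halt[of M' e v w] halt(1) code_eqD(2)[OF assms(3) e] by simp
next
  case (continue e v q w v')
  have e: "e \<in> nodes n M (shd (effect M e v))"
    using nodes_effect[OF assms(2) continue(5,4)] .
  have eff: "effect M' e v = effect M e v"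
    by (simp add: effect_def code_eqD(1)[OF assms(3) e])
  have "St q \<in> nodes n M (shd (effect M e v))"
    using nxt_closed[OF assms(2) e] continue(1) by simp
  then have "runs M' (St q) (effect M e v) w v'"
    using continue.IH effect_closed[OF continue(4)] by blast
  then show ?case
    using runs.continue[of M' e v q w v'] continue(1) code_eqD(2)[OF assms(3) e] eff by simp
qed

lemma represents_code:
  assumes "represents n M g" "represents n M' g'" "valid n M" "code n M = code n M'" "x \<in> \<X>"
  shows "g x = g' x"
proof -
  obtain w v where x: "x = w @- v" and v: "v \<in> \<X>" "w \<in> words n (shd v)"
    using words_decomposition[OF assms(5)] .
  obtain u u' where u: "runs M (Wd w) v u u'" "g x = u @- u'"
    using assms(1) v x unfolding represents_def by blast
  obtain z z' where z: "runs M' (Wd w) v z z'" "g' x = z @- z'"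
    using assms(2) v x unfolding represents_def by blast
  have "runs M' (Wd w) v u u'"
    using runs_code[OF u(1) assms(3,4)] v by simp
  then show ?thesis
    using runs_deterministic[OF _ z(1)] z(2) u(2) by simp
qed

text \<open>A set of size at most \<open>Suc K\<close> has size at most \<open>K\<close> or arises
  from such a set by one insertion, whence the factor \<open>card U + 1\<close>.\<close>

lemma card_bounded_subsets:
  assumes "finite U"
  shows "finite {A. A \<subseteq> U \<and> card A \<le> K}" "card {A. A \<subseteq> U \<and> card A \<le> K} \<le> (card U + 1) ^ K"
proof -
  show fin: "finite {A. A \<subseteq> U \<and> card A \<le> K}" for K
    by (rule finite_subset[of _ "Pow U"]) (use assms in auto)
  show "card {A. A \<subseteq> U \<and> card A \<le> K} \<le> (card U + 1) ^ K"
  proof (induction K)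
    case 0
    have "{A. A \<subseteq> U \<and> card A \<le> 0} \<subseteq> {{}}"
      using assms by (auto dest: finite_subset)
    then have "card {A. A \<subseteq> U \<and> card A \<le> 0} \<le> card {{} :: 'a set}"
      by (intro card_mono) auto
    then show ?case by simp
  next
    case (Suc K)
    let ?P = "\<lambda>K. {A. A \<subseteq> U \<and> card A \<le> K}"
    have "?P (Suc K) \<subseteq> ?P K \<union> (\<lambda>(x, A). insert x A) ` (U \<times> ?P K)"
    proof
      fix A assume A: "A \<in> ?P (Suc K)"
      show "A \<in> ?P K \<union> (\<lambda>(x, A). insert x A) ` (U \<times> ?P K)"
      proof (cases "A = {}")
        case False
        then obtain x where x: "x \<in> A" by blast
        have "finite A" using A assms finite_subset by blast
        then have "A - {x} \<in> ?P K" using A x by (auto simp: card_Diff_singleton)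
        moreover have "A = (\<lambda>(x, A). insert x A) (x, A - {x})" using x by auto
        moreover have "x \<in> U" using A x by auto
        ultimately show ?thesis by blast
      qed simp
    qed
    then have "card (?P (Suc K)) \<le> card (?P K \<union> (\<lambda>(x, A). insert x A) ` (U \<times> ?P K))"
      using fin assms by (intro card_mono) auto
    also have "\<dots> \<le> card (?P K) + card ((\<lambda>(x, A). insert x A) ` (U \<times> ?P K))"
      by (rule card_Un_le)
    also have "\<dots> \<le> card (?P K) + card (U \<times> ?P K)"
      using fin assms by (intro add_left_mono card_image_le) auto
    also have "\<dots> = (card U + 1) * card (?P K)"
      by (simp add: card_cartesian_product)
    also have "\<dots> \<le> (card U + 1) ^ Suc K"
      using mult_le_mono2[OF Suc.IH, of "card U + 1"] by simp
    finally show ?case .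
  qed
qed

section \<open>Machines of words and of group elements\<close>

definition word_machine :: "(index \<times> label) list \<Rightarrow> machine" where
  "word_machine gs =
     \<lparr>states = (\<lambda>t. {..<length gs}), idx = (\<lambda>q. fst (gs ! q)), lab = (\<lambda>q. Some (snd (gs ! q))),
      nxt = (\<lambda>e t. case e of
          St q \<Rightarrow> if Suc q < length gs then St (Suc q) else Wd []
        | Wd w \<Rightarrow> if gs = [] then Wd [] else St 0)\<rparr>"

definition act_word :: "(index \<times> label) list \<Rightarrow> bit stream \<Rightarrow> bit stream" where
  "act_word gs v = fold (\<lambda>(i, x). act i (Some x)) gs v"

lemma word_machine_simps [simp]:
  "states (word_machine gs) t = {..<length gs}"
  "idx (word_machine gs) q = fst (gs ! q)"
  "lab (word_machine gs) q = Some (snd (gs ! q))"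
  "nxt (word_machine gs) (St q) t = (if Suc q < length gs then St (Suc q) else Wd [])"
  "nxt (word_machine gs) (Wd w) t = (if gs = [] then Wd [] else St 0)"
  by (simp_all add: word_machine_def)

text \<open>At level 0 the only entry word is \<open>[]\<close>; the steps run cyclically through
  \<open>Wd []\<close> and the letters in order.\<close>

lemma valid_word_machine: "valid 0 (word_machine gs)"
  unfolding valid_def
proof (intro conjI allI ballI impI)
  fix t
  show "finite (states (word_machine gs) t)" by simp
  show "inj_on (\<lambda>e. nxt (word_machine gs) e t) (nodes 0 (word_machine gs) t)"
  proof (rule inj_onI)
    fix e e' assume "e \<in> nodes 0 (word_machine gs) t" "e' \<in> nodes 0 (word_machine gs) t"
      "nxt (word_machine gs) e t = nxt (word_machine gs) e' t"
    then show "e = e'"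
      by (cases e; cases e') (auto split: if_splits)
  qed
  fix e assume "e \<in> nodes 0 (word_machine gs) t"
  then show "nxt (word_machine gs) e t \<in> nodes 0 (word_machine gs) t"
    by (cases e) auto
qed simp

lemma runs_word_machine:
  assumes "q < length gs"
  shows "runs (word_machine gs) (St q) v [] (act_word (drop q gs) v)"
  using assms
proof (induction "length gs - q" arbitrary: q v)
  case (Suc k)
  let ?v = "effect (word_machine gs) (St q) v"
  have v: "act_word (drop q gs) v = act_word (drop (Suc q) gs) ?v"
    using Suc.prems by (simp add: act_word_def Cons_nth_drop_Suc[symmetric] case_prod_unfold)
  show ?case
  proof (cases "Suc q < length gs")
    case True
    have "runs (word_machine gs) (St (Suc q)) ?v [] (act_word (drop (Suc q) gs) ?v)"
      using Suc.hyps(1)[of "Suc q"] Suc.hyps(2) True by simp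
    then show ?thesis
      unfolding v by (rule runs.continue[rotated]) (use True in simp)
  next
    case False
    then have "act_word (drop q gs) v = ?v"
      unfolding v by (simp add: act_word_def)
    then show ?thesis
      using runs.halt[of "word_machine gs" "St q" v "[]"] False by simp
  qed
qed simp

lemma represents_word_machine: "represents 0 (word_machine gs) (act_word gs)"
  unfolding represents_def
proof (intro ballI)
  fix v w assume "v \<in> \<X>" "w \<in> words 0 (shd v)"
  then have w: "w = []" by simp
  have "runs (word_machine gs) (Wd w) v [] (act_word gs v)"
  proof (cases "gs = []")
    case True
    then show ?thesis
      using runs.halt[of "word_machine gs" "Wd w" v "[]"] by (simp add: act_word_def)
  next
    case False
    then have "runs (word_machine gs) (St 0) (effect (word_machine gs) (Wd w) v) [] (act_word gs v)"
      using runs_word_machine[of 0 gs v] by simp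
    then show ?thesis
      by (rule runs.continue[rotated]) (use False in simp)
  qed
  then show "\<exists>w' v'. runs (word_machine gs) (Wd w) v w' v' \<and> act_word gs (w @- v) = w' @- v'"
    using w by fastforce
qed

lemma weight_le_49: "weight y \<le> 49"
  by (cases y rule: weight.cases) simp_all

text \<open>The first renormalization makes the machine proper and only bounds the potential
  trivially by 49 per letter; this is why level \<open>Suc k\<close> goes with the exponent
  \<open>k\<close>.\<close>

lemma machine_of_word:
  "\<exists>M. valid (Suc k) M \<and> proper M \<and> states M 0 \<union> states M 1 \<subseteq> {..<length gs} \<and>
     represents (Suc k) M (act_word gs) \<and>
     real (potential M) \<le> 49 * ((6 / 7) ^ k * length gs) + 23 * 5 ^ Suc k"
proof (induction k)
  case 0
  let ?M = "renorm (word_machine gs)"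
  have sub: "states ?M t \<subseteq> {..<length gs}" for t
    by (auto simp: states_renorm)
  have "potential ?M \<le> (\<Sum>q\<in>alphas ?M. 49)"
    unfolding potential_def by (rule sum_mono) (rule weight_le_49)
  also have "\<dots> \<le> 49 * length gs"
  proof -
    have "alphas ?M \<subseteq> {..<length gs}" using sub by (auto simp: alphas_def)
    then have "card (alphas ?M) \<le> card {..<length gs}" by (intro card_mono) auto
    then show ?thesis by simp
  qed
  finally have "real (potential ?M) \<le> 49 * ((6 / 7) ^ 0 * length gs) + 23 * 5 ^ Suc 0"
    by simp
  then show ?case
    using valid_renorm[OF valid_word_machine, of gs] represents_renorm[OF represents_word_machine, of gs]
      proper_renorm sub[of 0] sub[of 1] by blast
next
  case (Suc k)
  then obtain M where M: "valid (Suc k) M" "proper M" "states M 0 \<union> states M 1 \<subseteq> {..<length gs}"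
    "represents (Suc k) M (act_word gs)"
    "real (potential M) \<le> 49 * ((6 / 7) ^ k * length gs) + 23 * 5 ^ Suc k"
    by blast
  obtain M' where M': "valid (Suc (Suc k)) M'" "proper M'" "\<And>t. states M' t \<subseteq> states M 0 \<union> states M 1"
    "\<And>g. represents (Suc k) M g \<Longrightarrow> represents (Suc (Suc k)) M' g"
    "7 * potential M' \<le> 6 * potential M + 133 * 5 ^ Suc (Suc k)"
    using renormalization_step[OF M(1,2)] by metis
  have "real (7 * potential M') \<le> real (6 * potential M + 133 * 5 ^ Suc (Suc k))"
    using M'(5) of_nat_mono by blast
  then have "7 * real (potential M') \<le> 6 * real (potential M) + 665 * 5 ^ Suc k"
    by simp
  \<comment> \<open>23 is the least integer \<open>c\<close> with
    \<open>6 * c + 665 \<le> 7 * 5 * c\<close>, so the error term reproduces itself.\<close>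
  moreover have "P' \<le> 49 * (6 / 7 * a) + 23 * (5 * b)"
    if "7 * P' \<le> 6 * P + 665 * b" "P \<le> 49 * a + 23 * b" "0 \<le> b" for P P' a b :: real
    using that by simp
  ultimately have "real (potential M') \<le> 49 * (6 / 7 * ((6 / 7) ^ k * length gs)) + 23 * (5 * 5 ^ Suc k)"
    using M(5) zero_le_power[of "5::real" "Suc k"] by fastforce
  then have "real (potential M') \<le> 49 * ((6 / 7) ^ Suc k * length gs) + 23 * 5 ^ Suc (Suc k)"
    by (simp add: mult.assoc)
  then show ?case
    using M' M(3,4) by (intro exI[of _ M']) blast
qed

lemma BijGroup_simps:
  "carrier (RBijGroup \<X>) = Bij \<X>"
  "g \<in> Bij \<X> \<Longrightarrow> h \<in> Bij \<X> \<Longrightarrow> g \<otimes>\<^bsub>\<G>\<^esub> h = compose \<X> h g"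
  "\<one>\<^bsub>\<G>\<^esub> = (\<lambda>v\<in>\<X>. v)"
  by (simp_all add: RBijGroup_def BijGroup_def \<G>_def)

text \<open>The product in \<open>\<G>\<close> lets the left factor act first, which is the order in
  which \<open>act_word\<close> folds the letters.\<close>

lemma foldr_generators:
  assumes "set ws \<subseteq> generators"
  shows "\<exists>gs. length gs = length ws \<and> foldr (\<lambda>s h. s \<otimes>\<^bsub>\<G>\<^esub> h) ws \<one>\<^bsub>\<G>\<^esub> \<in> Bij \<X> \<and>
    (\<forall>v\<in>\<X>. foldr (\<lambda>s h. s \<otimes>\<^bsub>\<G>\<^esub> h) ws \<one>\<^bsub>\<G>\<^esub> v = act_word gs v)"
  using assms
proof (induction ws)
  case Nil
  have "\<one>\<^bsub>\<G>\<^esub> \<in> Bij \<X>"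
    unfolding BijGroup_simps(3) by (rule id_Bij)
  moreover have "\<one>\<^bsub>\<G>\<^esub> v = v" if "v \<in> \<X>" for v
    using that by (simp add: BijGroup_simps(3))
  ultimately show ?case
    by (intro exI[of _ "[]"]) (simp add: act_word_def)
next
  case (Cons s ws)
  let ?h = "foldr (\<lambda>s h. s \<otimes>\<^bsub>\<G>\<^esub> h) ws \<one>\<^bsub>\<G>\<^esub>"
  from Cons obtain gs where gs: "length gs = length ws" "?h \<in> Bij \<X>" "\<And>v. v \<in> \<X> \<Longrightarrow> ?h v = act_word gs v"
    by auto
  have s: "s \<in> Bij \<X>"
    using Cons.prems generators_subset by (auto simp: BijGroup_simps(1))
  obtain f x where f: "f \<in> {act0, act1, act2}" "s = restrict (f x) \<X>"
    using Cons.prems by (auto simp: generators_def)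
  obtain i where i: "s = restrict (act i (Some x)) \<X>"
  proof -
    have "f x = act I0 (Some x) \<or> f x = act I1 (Some x) \<or> f x = act I2 (Some x)"
      using f(1) by (auto simp: fun_eq_iff)
    with f(2) that show thesis by metis
  qed
  have "compose \<X> ?h s v = act_word ((i, x) # gs) v" if "v \<in> \<X>" for v
    using that gs(3)[of "act i (Some x) v"] act_closed[OF that] i by (simp add: compose_def act_word_def)
  then show ?case
    using gs(1,2) s compose_Bij[OF gs(2) s]
    by (intro exI[of _ "(i, x) # gs"]) (simp add: BijGroup_simps(2))
qed

lemma \<G>_extensional: "g \<in> carrier \<G> \<Longrightarrow> g \<in> extensional \<X>"
  using group.generate_in_carrier[OF group_RBijGroup generators_subset] Bij_imp_extensional
  by (auto simp: \<G>_def BijGroup_simps(1))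

lemma word_of_element:
  assumes "g \<in> carrier \<G>"
  obtains gs where "length gs = word_length \<G> generators g" "\<And>v. v \<in> \<X> \<Longrightarrow> g v = act_word gs v"
proof -
  let ?p = "\<lambda>ws. foldr (\<lambda>s h. s \<otimes>\<^bsub>\<G>\<^esub> h) ws \<one>\<^bsub>\<G>\<^esub>"
  have "\<exists>l ws. length ws = l \<and> set ws \<subseteq> generators \<and> ?p ws = g"
    using \<G>_word[OF assms] by auto
  from LeastI_ex[OF this] obtain ws
    where ws: "length ws = word_length \<G> generators g" "set ws \<subseteq> generators" "?p ws = g"
    unfolding word_length_def by blast
  from foldr_generators[OF ws(2)] ws(1,3) that show thesis by auto
qed

section \<open>The number of codes\<close>

lemma UNIV_bit: "(UNIV :: bit set) = {0, 1}"
proof -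
  have "b \<in> {0, 1}" for b :: bit by (cases b) simp_all
  then show ?thesis by blast
qed

lemma finite_UNIV_bit: "finite (UNIV :: bit set)"
  and card_UNIV_bit: "card (UNIV :: bit set) = 2"
  by (simp_all add: UNIV_bit)

lemma finite_UNIV_letter: "finite (UNIV :: (index \<times> label option) set)"
  and card_UNIV_letter: "card (UNIV :: (index \<times> label option) set) = 15"
proof -
  have U: "(UNIV :: (index \<times> label option) set) = {I0, I1, I2} \<times> {None, Some La, Some Lb, Some Lc, Some Ld}"
    by (simp add: index_UNIV[symmetric] label_option_UNIV[symmetric])
  show "finite (UNIV :: (index \<times> label option) set)" unfolding U by simp
  show "card (UNIV :: (index \<times> label option) set) = 15" unfolding U by (simp add: card_cartesian_product)
qed

definition node_range :: "nat \<Rightarrow> nat \<Rightarrow> node set" where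
  "node_range L n = St ` {..<L} \<union> Wd ` {w. length w = 3 * n}"

lemma finite_node_range: "finite (node_range L n)"
  and card_node_range: "card (node_range L n) \<le> L + 8 ^ n"
proof -
  have W: "finite {w :: bit list. length w = 3 * n}" "card {w :: bit list. length w = 3 * n} = 8 ^ n"
    using finite_lists_length_eq[OF finite_UNIV_bit, of "3 * n"] card_lists_length_eq[OF finite_UNIV_bit, of "3 * n"]
    by (simp_all add: card_UNIV_bit power_mult)
  then show "finite (node_range L n)" by (simp add: node_range_def)
  have "card (node_range L n) \<le> card (St ` {..<L}) + card (Wd ` {w :: bit list. length w = 3 * n})"
    unfolding node_range_def by (rule card_Un_le)
  also have "\<dots> \<le> card {..<L} + card {w :: bit list. length w = 3 * n}"
    using W by (intro add_mono card_image_le) auto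
  finally show "card (node_range L n) \<le> L + 8 ^ n" using W by simp
qed

lemma card_code_le:
  assumes "valid n M" "states M 0 \<union> states M 1 \<subseteq> {..<L}"
  shows "code n M \<subseteq> node_range L n \<times> UNIV \<times> UNIV \<times> node_range L n"
    "card (code n M) \<le> 2 * card (states M 0 \<union> states M 1) + 2 * 5 ^ n"
proof -
  have states: "states M t \<subseteq> states M 0 \<union> states M 1" for t
    by (cases t) auto
  have nodes: "nodes n M t \<subseteq> node_range L n" for t
    using subset_trans[OF states assms(2), of t] length_words
    unfolding nodes_def node_range_def by blast
  then show "code n M \<subseteq> node_range L n \<times> UNIV \<times> UNIV \<times> node_range L n"
    using nxt_closed[OF assms(1)] unfolding code_def by blast
  have card_nodes: "card (nodes n M t) \<le> card (states M 0 \<union> states M 1) + 5 ^ n" for t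
  proof -
    have fin: "finite (states M 0 \<union> states M 1)" using assms(1) by (simp add: valid_def)
    have "card (nodes n M t) \<le> card (St ` states M t) + card (Wd ` words n t)"
      unfolding nodes_def by (rule card_Un_le)
    also have "\<dots> \<le> card (states M t) + card (words n t)"
      using finite_subset[OF states fin] by (intro add_mono card_image_le) auto
    also have "\<dots> \<le> card (states M 0 \<union> states M 1) + 5 ^ n"
      by (intro add_mono card_mono fin states card_words_le)
    finally show ?thesis .
  qed
  let ?c = "\<lambda>t e. (e, t, letter M e, nxt M e t)"
  have "code n M \<subseteq> ?c 0 ` nodes n M 0 \<union> ?c 1 ` nodes n M 1"
  proof
    fix x assume "x \<in> code n M"
    then obtain t where "x \<in> ?c t ` nodes n M t"
      unfolding code_def by (rule UN_E)
    then show "x \<in> ?c 0 ` nodes n M 0 \<union> ?c 1 ` nodes n M 1"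
      by (cases t) (simp_all only: Un_iff simp_thms)
  qed
  then have "card (code n M) \<le> card (?c 0 ` nodes n M 0 \<union> ?c 1 ` nodes n M 1)"
    by (intro card_mono finite_UnI finite_imageI finite_nodes[OF assms(1)])
  also have "\<dots> \<le> card (?c 0 ` nodes n M 0) + card (?c 1 ` nodes n M 1)"
    by (rule card_Un_le)
  also have "\<dots> \<le> card (nodes n M 0) + card (nodes n M 1)"
    by (intro add_mono card_image_le finite_nodes[OF assms(1)])
  finally show "card (code n M) \<le> 2 * card (states M 0 \<union> states M 1) + 2 * 5 ^ n"
    using card_nodes[of 0] card_nodes[of 1] by linarith
qed

text \<open>The base \<open>35 / 6 = 5 * (7 / 6)\<close> balances the decay
  \<open>(6 / 7) ^ k\<close> of the potential against the growth \<open>5 ^ k\<close> of the tiles.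
  One further renormalization turns the bound on the potential into a bound on the number of
  states.\<close>

lemma machine_of_element:
  assumes g: "g \<in> carrier \<G>" "real (word_length \<G> generators g) \<le> R" and R: "R < (35 / 6) ^ Suc k"
  shows "\<exists>M h. valid (k + 2) M \<and> represents (k + 2) M h \<and> (\<forall>v\<in>\<X>. g v = h v) \<and>
    states M 0 \<union> states M 1 \<subseteq> {..<nat \<lfloor>R\<rfloor>} \<and> card (code (k + 2) M) \<le> 1102 * 5 ^ k"
proof -
  obtain gs where gs: "length gs = word_length \<G> generators g" "\<And>v. v \<in> \<X> \<Longrightarrow> g v = act_word gs v"
    using word_of_element[OF g(1)] by blast
  have len: "real (length gs) \<le> R" "length gs \<le> nat \<lfloor>R\<rfloor>"
    using g(2) gs(1) by (simp_all add: le_nat_floor)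
  obtain M where M: "valid (Suc k) M" "proper M" "states M 0 \<union> states M 1 \<subseteq> {..<length gs}"
    "represents (Suc k) M (act_word gs)"
    "real (potential M) \<le> 49 * ((6 / 7) ^ k * length gs) + 23 * 5 ^ Suc k"
    using machine_of_word[of k gs] by blast
  obtain M' where M': "valid (Suc (Suc k)) M'" "\<And>t. states M' t \<subseteq> states M 0 \<union> states M 1"
    "\<And>g. represents (Suc k) M g \<Longrightarrow> represents (Suc (Suc k)) M' g"
    "card (states M' 0 \<union> states M' 1) \<le> potential M + 5 * 5 ^ Suc (Suc k)"
    using renormalization_step[OF M(1,2)] by metis
  have "(6 / 7) ^ k * real (length gs) \<le> (6 / 7) ^ k * (35 / 6) ^ Suc k"
    using len(1) R by (intro mult_left_mono) auto
  also have "\<dots> = 35 / 6 * (6 / 7 * (35 / 6)) ^ k"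
    by (simp only: power_mult_distrib power_Suc mult_ac)
  also have "\<dots> = 35 / 6 * 5 ^ k" by simp
  \<comment> \<open>\<open>49 * 35 / 6 + 115 < 401\<close>. Below, \<open>401 + 125 = 526\<close>
    bounds the states and \<open>2 * 526 + 2 * 25 = 1102\<close> the code.\<close>
  finally have "real (potential M) \<le> real (401 * 5 ^ k)"
    using M(5) by simp
  then have "potential M \<le> 401 * 5 ^ k"
    by (simp only: of_nat_le_iff)
  then have card: "card (states M' 0 \<union> states M' 1) \<le> 526 * 5 ^ k"
    using M'(4) by simp
  have sub: "states M' 0 \<union> states M' 1 \<subseteq> {..<nat \<lfloor>R\<rfloor>}"
    using M'(2) M(3) len(2) by fastforce
  have "card (code (k + 2) M') \<le> 1102 * 5 ^ k"
    using card_code_le(2)[OF M'(1) sub] card by simp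
  with M'(1) M'(3)[OF M(4)] gs(2) sub show ?thesis
    by (intro exI[of _ M'] exI[of _ "act_word gs"]) simp
qed

text \<open>The code of its machine determines an element on \<open>\<X>\<close>, hence entirely,
  since elements are extensional. It remains to count small subsets of a universe of polynomial size
  in \<open>R\<close>.\<close>

lemma growth_bound:
  assumes R: "(35 / 6) ^ k \<le> R" "R < (35 / 6) ^ Suc k"
  shows "real (growth \<G> generators R) \<le> (131072 * R ^ 4) ^ (1102 * 5 ^ k)"
proof -
  let ?B = "{g \<in> carrier \<G>. real (word_length \<G> generators g) \<le> R}"
  let ?n = "k + 2" and ?K = "1102 * 5 ^ k :: nat" and ?N = "node_range (nat \<lfloor>R\<rfloor>) (k + 2)"
  let ?U = "?N \<times> (UNIV :: bit set) \<times> (UNIV :: (index \<times> label option) set) \<times> ?N"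
  have "\<forall>g\<in>?B. \<exists>M h. valid ?n M \<and> represents ?n M h \<and> (\<forall>v\<in>\<X>. g v = h v) \<and>
    states M 0 \<union> states M 1 \<subseteq> {..<nat \<lfloor>R\<rfloor>} \<and> card (code ?n M) \<le> ?K"
    using machine_of_element R(2) by blast
  then obtain m h where mh: "\<And>g. g \<in> ?B \<Longrightarrow> valid ?n (m g) \<and> represents ?n (m g) (h g) \<and> (\<forall>v\<in>\<X>. g v = h g v) \<and>
    states (m g) 0 \<union> states (m g) 1 \<subseteq> {..<nat \<lfloor>R\<rfloor>} \<and> card (code ?n (m g)) \<le> ?K"
    unfolding bchoice_iff by blast
  have inj: "inj_on (\<lambda>g. code ?n (m g)) ?B"
  proof (rule inj_onI)
    fix g g' assume g: "g \<in> ?B" "g' \<in> ?B" and eq: "code ?n (m g) = code ?n (m g')"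
    have "g v = g' v" if v: "v \<in> \<X>" for v
      using represents_code[of ?n "m g" "h g" "m g'" "h g'" v] mh[OF g(1)] mh[OF g(2)] eq v by simp
    then show "g = g'"
      using \<G>_extensional g by (intro extensionalityI[of _ \<X>]) auto
  qed
  have finU: "finite ?U"
    using finite_node_range finite_UNIV_bit finite_UNIV_letter by blast
  have "(\<lambda>g. code ?n (m g)) ` ?B \<subseteq> {A. A \<subseteq> ?U \<and> card A \<le> ?K}"
    using card_code_le(1) mh by blast
  then have "card ?B \<le> card {A. A \<subseteq> ?U \<and> card A \<le> ?K}"
    by (rule card_inj_on_le[OF inj _ card_bounded_subsets(1)[OF finU]])
  also have "\<dots> \<le> (card ?U + 1) ^ ?K"
    by (rule card_bounded_subsets(2)[OF finU])
  finally have "real (growth \<G> generators R) \<le> real ((card ?U + 1) ^ ?K)"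
    unfolding growth_def by (rule of_nat_mono)
  also have "\<dots> = real (card ?U + 1) ^ ?K"
    by (rule of_nat_power)
  also have "\<dots> \<le> (131072 * R ^ 4) ^ ?K"
  proof (rule power_mono)
    have R1: "1 \<le> R" using R(1) one_le_power[of "35 / 6 :: real" k] by linarith
    \<comment> \<open>\<open>8 < (35 / 6)\<^sup>2\<close>, so even the crude count of all bit lists
      stays polynomial in \<open>R\<close>.\<close>
    have "(8::real) ^ k \<le> ((35 / 6)\<^sup>2) ^ k"
      by (rule power_mono) (simp_all add: power2_eq_square)
    also have "\<dots> = ((35 / 6) ^ k)\<^sup>2" by (simp only: power_mult[symmetric] mult.commute)
    also have "\<dots> \<le> R\<^sup>2" using R(1) by (rule power_mono) simp
    finally have 8: "(8::real) ^ k \<le> R\<^sup>2" .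
    have "real (card ?N) \<le> real (nat \<lfloor>R\<rfloor> + 8 ^ (k + 2))"
      using card_node_range of_nat_mono by blast
    also have "\<dots> \<le> R + 64 * 8 ^ k"
      using R1 by simp
    also have "\<dots> \<le> R\<^sup>2 + 64 * R\<^sup>2"
      using 8 R1 self_le_power[of R 2] by simp
    finally have N: "real (card ?N) \<le> 65 * R\<^sup>2" by simp
    have "card ?U = 30 * (card ?N * card ?N)"
      by (simp add: card_cartesian_product card_UNIV_bit card_UNIV_letter)
    then have "real (card ?U + 1) = 30 * (real (card ?N) * real (card ?N)) + 1"
      by simp
    also have "\<dots> \<le> 30 * ((65 * R\<^sup>2) * (65 * R\<^sup>2)) + 1"
      using mult_mono[OF N N] by simp
    also have "\<dots> = 126750 * R ^ 4 + 1"
      by (simp add: power2_eq_square power4_eq_xxxx)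
    \<comment> \<open>\<open>131072 = 2 ^ 17\<close> absorbs the added 1 and has a convenient
      logarithm.\<close>
    also have "\<dots> \<le> 131072 * R ^ 4"
      using one_le_power[OF R1, of 4] by linarith
    finally show "real (card ?U + 1) \<le> 131072 * R ^ 4" .
  qed simp
  finally show ?thesis .
qed

section \<open>Real estimates and the final exponent\<close>

lemma five_power_le:
  fixes R :: real
  assumes "(35 / 6) ^ k \<le> R"
  shows "5 ^ k \<le> R powr (11 / 12)"
proof -
  have R: "0 < R" using assms less_le_trans[OF zero_less_power[of "35 / 6 :: real" k]] by simp
  have "((5::real) ^ k) ^ 12 = (5 ^ 12) ^ k"
    by (simp only: power_mult[symmetric] mult.commute)
  \<comment> \<open>The numerical fact \<open>5 ^ 12 \<le> (35 / 6) ^ 11\<close> is the source of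
    the exponent \<open>11 / 12\<close>.\<close>
  also have "\<dots> \<le> ((35 / 6) ^ 11) ^ k"
    by (rule power_mono) (simp_all add: power_divide)
  also have "\<dots> = ((35 / 6) ^ k) ^ 11"
    by (simp only: power_mult[symmetric] mult.commute)
  also have "\<dots> \<le> R ^ 11"
    using assms by (rule power_mono) simp
  also have "\<dots> = (R powr (11 / 12)) ^ 12"
    using R powr_realpow[of R 11] by (simp add: powr_power)
  finally show ?thesis
    using power_mono_iff[of "5 ^ k" "R powr (11 / 12)" 12] by simp
qed

lemma ex_power_bracket:
  fixes b R :: real
  assumes "1 < b" "1 \<le> R"
  obtains k where "b ^ k \<le> R" "R < b ^ Suc k"
proof -
  have ex: "\<exists>n. R < b ^ n" using real_arch_pow[OF assms(1)] .
  define n where "n = (LEAST n. R < b ^ n)"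
  have n: "R < b ^ n" unfolding n_def by (rule LeastI_ex[OF ex])
  then have "n \<noteq> 0" using assms(2) by (intro notI) simp
  then obtain k where k: "n = Suc k" using not0_implies_Suc by blast
  have "\<not> R < b ^ k" using not_less_Least[of k "\<lambda>n. R < b ^ n"] k unfolding n_def by simp
  with n k that[of k] show thesis by simp
qed

theorem mainTheorem2:
  shows "(\<lambda>R. real (growth \<G> generators R)) \<preceq> (\<lambda>R. exp (R powr 0.9181))"
proof -
  \<comment> \<open>1102 comes from the code size, 17 from \<open>ln (2 ^ 17)\<close>, and
    \<open>4 * 1000\<close> from \<open>4 * ln R \<le> 4 * R powr 0.001 / 0.001\<close>.
    \<open>C\<close> turns the factor \<open>D\<close> into a rescaling of \<open>R\<close>.\<close>
  define D :: real where "D = 1102 * (17 + 4 * 1000)"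
  define C where "C = D powr (1 / 0.9181)"
  have "1 \<le> C"
    unfolding C_def by (rule ge_one_powr_ge_zero) (simp_all add: D_def)
  moreover have "real (growth \<G> generators R) \<le> exp ((C * R) powr 0.9181)" if R: "1 \<le> R" for R
  proof -
    obtain k where k: "(35 / 6) ^ k \<le> R" "R < (35 / 6) ^ Suc k"
      using ex_power_bracket[of "35 / 6" R] R by auto
    have pos: "0 < 131072 * R ^ 4" using R by simp
    have "ln (131072 * R ^ 4) = ln (2 ^ 17) + 4 * ln R"
      using R by (simp add: ln_mult ln_realpow)
    also have "ln (2 ^ 17 :: real) = 17 * ln 2"
      by (simp only: ln_realpow of_nat_numeral)
    also have "17 * ln 2 \<le> (17::real)"
      using ln_2_less_1 by simp
    finally have "ln (131072 * R ^ 4) \<le> 17 + 4 * ln R" by simp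
    also have "ln R \<le> R powr 0.001 / 0.001"
      by (rule ln_powr_bound[OF R]) simp
    also have "17 + 4 * (R powr 0.001 / 0.001) \<le> (17 + 4 * 1000) * R powr 0.001"
      using ge_one_powr_ge_zero[OF R, of "0.001"] by simp
    finally have ln: "ln (131072 * R ^ 4) \<le> (17 + 4 * 1000) * R powr 0.001" by simp
    have "real (growth \<G> generators R) \<le> (131072 * R ^ 4) ^ (1102 * 5 ^ k)"
      by (rule growth_bound[OF k])
    also have "\<dots> = exp (real (1102 * 5 ^ k) * ln (131072 * R ^ 4))"
      by (simp only: exp_of_nat_mult exp_ln[OF pos])
    also have "real (1102 * 5 ^ k) = 1102 * 5 ^ k"
      by simp
    also have "1102 * 5 ^ k * ln (131072 * R ^ 4)
      \<le> 1102 * R powr (11 / 12) * ((17 + 4 * 1000) * R powr 0.001)"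
    proof (rule mult_mono)
      show "0 \<le> ln (131072 * R ^ 4)"
        using one_le_power[OF R, of 4] by (intro ln_ge_zero) linarith
    qed (use five_power_le[OF k(1)] ln in simp_all)
    also have "\<dots> = D * R powr (11 / 12 + 0.001)"
      unfolding D_def powr_add by (simp only: mult_ac)
    \<comment> \<open>\<open>11 / 12 + 0.001 < 0.9181\<close>: the gap above \<open>11 / 12\<close>
      absorbs the logarithmic factor.\<close>
    also have "\<dots> \<le> D * R powr 0.9181"
      using R by (intro mult_left_mono powr_mono) (simp_all add: D_def)
    also have "\<dots> = (C * R) powr 0.9181"
      using R by (simp add: C_def powr_mult powr_powr D_def)
    finally show ?thesis by simp
  qed
  ultimately show ?thesis
    unfolding growth_le_def by blast
qed

end
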